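(* Let $N\ge1$, $\boldsymbol{k}=(k_1,\ldots,k_r)\in\mathbb{Z}_{>0}^r$ and $\boldsymbol{\eta}=(\eta_1,\ldots,\eta_r)\in\mu_N^r$. Then there is a positive integer $J$ depending on $\boldsymbol{k}$ such that, as $m\to\infty$, \begin{align*} z_m\left(\begin{array}{c}\eta_1,\ldots,\eta_r\\k_1,\ldots,k_r\end{array};e^{\frac{2\pi i}{m}}\right)=&\sum_{j=0}^r(-1)^{k_1+\cdots+k_j}(\eta_1\cdots\eta_j)^m\, L_\ast\left(\begin{array}{c}\overline{\eta}_j,\ldots,\overline{\eta}_1\\k_j,\ldots,k_1\end{array};\log\frac{m}{\pi}+\gamma+\frac{\pi i}{2}\right)\\ &\times L_\ast\left(\begin{array}{c}\eta_{j+1},\ldots,\eta_r\\k_{j+1},\ldots,k_r\end{array};\log\frac{m}{\pi}+\gamma-\frac{\pi i}{2}\right)+O\left(\frac{\log^Jm}{m}\right), \end{align*} where $\gamma$ is the Euler constant and $\overline{\eta}$ is the complex conjugate.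
   Context: $\mu_N$ is the set of $N$-th roots of unity. For a positive integer $m$ and $q\in\mathbb{C}$, $z_m\left(\begin{smallmatrix}\eta_1,\ldots,\eta_r\\k_1,\ldots,k_r\end{smallmatrix};q\right)=\sum_{m>m_1>\cdots>m_r>0}\frac{\eta_1^{m_1}\cdots\eta_r^{m_r}}{[m_1]_q^{k_1}\cdots[m_r]_q^{k_r}}$ with $[n]_q=\frac{1-q^n}{1-q}$. For an index (a pair of tuples $(\eta_1,\ldots,\eta_r)\in\mu_N^r$, $(k_1,\ldots,k_r)\in\mathbb{Z}_{>0}^r$) the truncated colored multiple zeta value is $L_m\binom{\eta_1,\ldots,\eta_r}{k_1,\ldots,k_r}=\sum_{m>m_1>\cdots>m_r>0}\frac{\eta_1^{m_1}\cdots\eta_r^{m_r}}{m_1^{k_1}\cdots m_r^{k_r}}$, and $L_\ast\left(\begin{smallmatrix}\eta_1,\ldots,\eta_r\\k_1,\ldots,k_r\end{smallmatrix};T\right)\in\mathbb{C}[T]$ denotes the (harmonic-regularized) polynomial, which exists and is unique, such that $L_m\binom{\eta_1,\ldots,\eta_r}{k_1,\ldots,k_r}=L_\ast\left(\begin{smallmatrix}\eta_1,\ldots,\eta_r\\k_1,\ldots,k_r\end{smallmatrix};\log m+\gamma\right)+O(\log^{J'}m/m)$ as $m\to\infty$ for some positive integer $J'$. For the empty index (depth $0$), $L_\ast=1$. *)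

theory Defs
  imports
    "HOL-Analysis.Analysis"
    "HOL-Computational_Algebra.Polynomial"
    "HOL-Library.Landau_Symbols"
begin

definition roots_of_unity :: "nat \<Rightarrow> complex set" where
  "roots_of_unity N = {z. z ^ N = 1}"

definition q_int :: "complex \<Rightarrow> nat \<Rightarrow> complex" where
  "q_int q n = (1 - q ^ n) / (1 - q)"

text \<open>
  The \<open>r\<close>-tuples with \<open>m > m\<^sub>1 > \<dots> > m\<^sub>r > 0\<close>. All tuples are lists indexed from 0,
  so the entry \<open>m\<^sub>i\<close> is \<open>ms ! (i - 1)\<close>. For \<open>r = 0\<close> the only tuple is the empty list.
\<close>

definition dec_tuples :: "nat \<Rightarrow> nat \<Rightarrow> nat list set" where
  "dec_tuples m r = {ms. length ms = r \<and> sorted_wrt (>) ms \<and> set ms \<subseteq> {0<..<m}}"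

lemma finite_dec_tuples: "finite (dec_tuples m r)"
  by (rule finite_subset[OF _ finite_lists_length_eq[of "{0<..<m}" r]])
     (auto simp: dec_tuples_def)

definition z_trunc :: "nat \<Rightarrow> complex list \<Rightarrow> nat list \<Rightarrow> complex \<Rightarrow> complex" where
  "z_trunc m \<eta>s ks q =
     (\<Sum>ms\<in>dec_tuples m (length ks).
        (\<Prod>i<length ks. \<eta>s ! i ^ (ms ! i)) / (\<Prod>i<length ks. q_int q (ms ! i) ^ (ks ! i)))"

definition L_trunc :: "nat \<Rightarrow> complex list \<Rightarrow> nat list \<Rightarrow> complex" where
  "L_trunc m \<eta>s ks =
     (\<Sum>ms\<in>dec_tuples m (length ks).
        (\<Prod>i<length ks. \<eta>s ! i ^ (ms ! i)) / (\<Prod>i<length ks. of_nat (ms ! i) ^ (ks ! i)))"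

text \<open>
  The harmonic-regularized polynomial, characterized by its asymptotic property; it exists and is
  unique when \<open>\<eta>s\<close> and \<open>ks\<close> have equal length, the \<open>\<eta>s\<close> are roots of unity and the \<open>ks\<close> are
  positive. For the empty index it is the constant 1, since then \<open>L_trunc m [] [] = 1\<close>.
\<close>

definition L_star :: "complex list \<Rightarrow> nat list \<Rightarrow> complex poly" where
  "L_star \<eta>s ks =
     (THE P. \<exists>J>0.
        (\<lambda>m::nat. L_trunc m \<eta>s ks - poly P (of_real (ln (real m)) + euler_mascheroni))
          \<in> O(\<lambda>m. of_real (ln (real m) ^ J / real m)))"

end

theory Submission
  imports Defs "HOL-Real_Asymp.Real_Asymp"
begin

text \<open>
  Cut the sum defining \<open>z\<^sub>m\<close> at \<open>m / 2\<close>. On the upper half the substitution \<open>n \<mapsto> m - n\<close> turns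
  \<open>1 / [n]\<close> into \<open>- q\<close> times the complex conjugate of \<open>1 / [n]\<close>, so it suffices to treat the sums
  over \<open>n < m / 2\<close>. There \<open>1 / [n]\<close> and its first difference agree with those of \<open>1 / n\<close> up to a
  relative error \<open>O(n / m)\<close>. Hence, for an index that does not start with the letter \<open>(1, 1)\<close>, the
  sum has the same limit as \<open>L\<^sub>m\<close>. Only the sum of \<open>1 / [n]\<close> itself differs: it is
  \<open>ln (m / \<pi>) + \<gamma> - \<pi> \<i> / 2\<close>, since \<open>1 / (1 - e\<^sup>2\<^sup>i\<^sup>y) = (1 + \<i> cot y) / 2\<close>. Finally
  the harmonic product expresses every sum, for both kinds of coefficients, by one and the same
  polynomial in the sum of the letter \<open>(1, 1)\<close> over convergent ones, and this polynomial is
  \<open>L\<^sub>*\<close>.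
\<close>

section \<open>Iterated sums and the harmonic product\<close>

text \<open>At n of order m the relative distance between 1 / [n] and 1 / n is no longer small, so
  comparing term by term does not suffice. A relative error O(n / m) is harmless exactly for terms
  of size log^l n / n^2: the factor n turns the error into 1 / m times a harmonic sum. Leading
  letters (\<eta>, k) with k \<ge> 2 give such terms at once; (\<eta>, 1) with \<eta> \<noteq> 1
  gives them after partial summation, and this is the reason for controlling first differences. For
  (1, 1) neither device applies, which is why it has to be isolated algebraically. The cut keeps n
  away from m, where [n] vanishes. All limits and polynomials are fixed before the coefficients are:
  the coefficients 1 / n identify the polynomial as \<open>L_star\<close>, and it is then available
  for 1 / [n]. On the upper half, conjugation changes the sign of \<pi> \<i> / 2, and the leftover
  power of q is 1 + O(1 / m), so that only the sign of (-q)^k survives.\<close>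

fun iter_sum :: "nat \<Rightarrow> nat \<Rightarrow> (nat \<Rightarrow> 'a::comm_semiring_1) list \<Rightarrow> 'a" where
  "iter_sum l N [] = 1"
| "iter_sum l N (f # fs) = (\<Sum>n\<in>{l..<N}. f n * iter_sum l n fs)"

lemma dec_tuples_0: "dec_tuples m 0 = {[]}"
  by (auto simp: dec_tuples_def)

lemma dec_tuples_Suc: "dec_tuples m (Suc r) = (\<Union>n\<in>{1..<m}. (#) n ` dec_tuples n r)"
proof (intro set_eqI iffI)
  fix ms assume "ms \<in> dec_tuples m (Suc r)"
  then show "ms \<in> (\<Union>n\<in>{1..<m}. (#) n ` dec_tuples n r)"
    by (cases ms) (auto simp: dec_tuples_def image_iff)
next
  fix ms assume "ms \<in> (\<Union>n\<in>{1..<m}. (#) n ` dec_tuples n r)"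
  then show "ms \<in> dec_tuples m (Suc r)"
    by (fastforce simp: dec_tuples_def)
qed

lemma sum_dec_tuples_eq_iter_sum:
  fixes fs :: "(nat \<Rightarrow> 'a::comm_semiring_1) list"
  shows "(\<Sum>ms\<in>dec_tuples m (length fs). \<Prod>i<length fs. (fs ! i) (ms ! i)) = iter_sum 1 m fs"
proof (induction fs arbitrary: m)
  case Nil
  then show ?case by (simp add: dec_tuples_0)
next
  case (Cons f fs)
  have "(\<Sum>ms\<in>dec_tuples m (length (f # fs)). \<Prod>i<length (f # fs). ((f # fs) ! i) (ms ! i)) =
    (\<Sum>n\<in>{1..<m}. \<Sum>ms\<in>(#) n ` dec_tuples n (length fs).
      \<Prod>i<length (f # fs). ((f # fs) ! i) (ms ! i))"
    unfolding length_Cons dec_tuples_Suc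
    by (subst sum.UNION_disjoint) (auto intro: finite_dec_tuples)
  also have "\<dots> = (\<Sum>n\<in>{1..<m}. f n * iter_sum 1 n fs)"
  proof (rule sum.cong[OF refl])
    fix n assume "n \<in> {1..<m}"
    show "(\<Sum>ms\<in>(#) n ` dec_tuples n (length fs). \<Prod>i<length (f # fs). ((f # fs) ! i) (ms ! i)) =
      f n * iter_sum 1 n fs"
      unfolding Cons.IH[symmetric] sum_distrib_left
      by (subst sum.reindex) (auto simp: prod.lessThan_Suc_shift inj_on_def simp del: prod.lessThan_Suc)
  qed
  finally show ?case by simp
qed

text \<open>The indices decrease along the list, so those that are at least \<open>M\<close> belong
  to an initial segment of \<open>fs\<close>; \<open>j\<close> is its length.\<close>

lemma iter_sum_split:
  assumes "l \<le> M" "M \<le> N"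
  shows "iter_sum l N fs =
    (\<Sum>j\<le>length fs. iter_sum M N (take j fs) * iter_sum l M (drop j fs))"
  using assms(2)
proof (induction fs arbitrary: N)
  case Nil
  then show ?case by simp
next
  case (Cons f fs)
  have "iter_sum l N (f # fs) = (\<Sum>n\<in>{l..<M}. f n * iter_sum l n fs) + (\<Sum>n\<in>{M..<N}. f n * iter_sum l n fs)"
    using assms(1) Cons.prems by (simp add: sum.atLeastLessThan_concat)
  also have "(\<Sum>n\<in>{M..<N}. f n * iter_sum l n fs) =
     (\<Sum>n\<in>{M..<N}. \<Sum>j\<le>length fs. f n * iter_sum M n (take j fs) * iter_sum l M (drop j fs))"
    by (intro sum.cong refl) (simp add: Cons.IH sum_distrib_left mult.assoc)
  also have "\<dots> = (\<Sum>j\<le>length fs. iter_sum M N (f # take j fs) * iter_sum l M (drop j fs))"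
    by (subst sum.swap) (simp add: sum_distrib_right)
  finally show ?case
    by (simp add: sum.atMost_Suc_shift del: sum.atMost_Suc)
qed

text \<open>The recursion of \<open>iter_sum\<close> peels off the largest index; this is the
  companion for the smallest one, needed because a reflection exchanges the two ends.\<close>

lemma iter_sum_snoc:
  "iter_sum l N (fs @ [g]) = (\<Sum>n\<in>{l..<N}. g n * iter_sum (Suc n) N fs)"
proof (induction fs arbitrary: N)
  case Nil
  then show ?case by simp
next
  case (Cons f fs)
  have "iter_sum l N ((f # fs) @ [g]) =
    (\<Sum>n\<in>{l..<N}. \<Sum>n'\<in>{l..<n}. g n' * (f n * iter_sum (Suc n') n fs))"
    by (simp add: Cons.IH sum_distrib_left mult_ac)
  also have "\<dots> = (\<Sum>n'\<in>{l..<N}. \<Sum>n\<in>{Suc n'..<N}. g n' * (f n * iter_sum (Suc n') n fs))"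
    unfolding sum.Sigma[OF finite_atLeastLessThan ballI[OF finite_atLeastLessThan]]
    by (rule sum.reindex_bij_witness[where i = prod.swap and j = prod.swap]) auto
  finally show ?case by (simp add: sum_distrib_left)
qed

text \<open>The map n \<mapsto> m - n reverses the order of the indices, hence \<open>rev\<close>.
  It carries the half-open interval from \<open>l\<close> to \<open>N\<close> to the one from
  \<open>Suc m - N\<close> to \<open>Suc m - l\<close>; the shift by one comes from exchanging the
  closed end with the open one.\<close>

lemma iter_sum_reflect:
  assumes "N \<le> Suc m" "l \<le> N"
  shows "iter_sum l N fs =
    iter_sum (Suc m - N) (Suc m - l) (rev (map (\<lambda>f n. f (m - n)) fs))"
  using assms
proof (induction fs arbitrary: N)
  case Nil
  then show ?case by simp
next
  case (Cons f fs)
  have "iter_sum l N (f # fs) = (\<Sum>n\<in>{l..<N}. f n *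
     iter_sum (Suc m - n) (Suc m - l) (rev (map (\<lambda>f n. f (m - n)) fs)))"
    using Cons.prems by (auto intro!: sum.cong simp: Cons.IH)
  also have "\<dots> = (\<Sum>n\<in>{Suc m - N..<Suc m - l}. f (m - n) *
     iter_sum (Suc n) (Suc m - l) (rev (map (\<lambda>f n. f (m - n)) fs)))"
    by (rule sum.reindex_bij_witness[where i = "\<lambda>n. m - n" and j = "\<lambda>n. m - n"])
       (use Cons.prems in \<open>auto simp: Suc_diff_le\<close>)
  finally show ?case by (simp add: iter_sum_snoc)
qed

lemma iter_sum_cong:
  assumes "list_all2 (\<lambda>f g. \<forall>n\<in>{l..<N}. f n = g n) fs gs"
  shows "iter_sum l N fs = iter_sum l N gs"
  using assms
proof (induction fs arbitrary: gs N)
  case (Cons f fs)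
  then obtain g gs' where gs: "gs = g # gs'" "\<forall>n\<in>{l..<N}. f n = g n"
    "list_all2 (\<lambda>f g. \<forall>n\<in>{l..<N}. f n = g n) fs gs'"
    by (auto simp: list_all2_Cons1)
  have "iter_sum l n fs = iter_sum l n gs'" if "n \<in> {l..<N}" for n
    by (rule Cons.IH) (use gs(3) that in \<open>auto elim!: list_all2_mono\<close>)
  then show ?case using gs(1,2) by simp
qed simp

lemma iter_sum_scale:
  "iter_sum l N (map (\<lambda>x n. c x * f x n) xs) =
    prod_list (map c xs) * iter_sum l N (map f xs)"
  by (induction xs arbitrary: N) (auto simp: sum_distrib_left mult_ac)

lemma iter_sum_cnj:
  "cnj (iter_sum l N fs) = iter_sum l N (map (\<lambda>f n. cnj (f n)) fs)"
  by (induction fs arbitrary: N) auto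

section \<open>Colored sums as functions of words in the letters (\<eta>, k)\<close>

definition letter :: "(nat \<Rightarrow> complex) \<Rightarrow> complex \<times> nat \<Rightarrow> nat \<Rightarrow> complex" where
  "letter a x n = fst x ^ n * a n ^ snd x"

text \<open>The sequence \<open>a\<close> holds the reciprocals 1 / [n] or 1 / n, so that
  \<open>z_trunc\<close> and \<open>L_trunc\<close> are values of the same function of a
  word.\<close>

definition csum :: "(nat \<Rightarrow> complex) \<Rightarrow> nat \<Rightarrow> (complex \<times> nat) list \<Rightarrow> complex" where
  "csum a N w = iter_sum 1 N (map (letter a) w)"

lemma csum_Nil [simp]: "csum a N [] = 1"
  by (simp add: csum_def)

lemma csum_Cons: "csum a N (x # w) = (\<Sum>n\<in>{1..<N}. letter a x n * csum a n w)"
  by (simp add: csum_def)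

lemma csum_Cons_Suc:
  "N \<ge> 1 \<Longrightarrow> csum a (Suc N) (x # w) = csum a N (x # w) + letter a x N * csum a N w"
  by (simp add: csum_Cons)

lemma csum_cnj: "cnj (csum a N w) = csum (\<lambda>n. cnj (a n)) N (map (map_prod cnj id) w)"
  by (simp add: csum_def iter_sum_cnj letter_def[abs_def] comp_def)

lemma sum_dec_tuples_eq_csum:
  assumes "length \<eta>s = length ks"
  shows "(\<Sum>ms\<in>dec_tuples m (length ks).
      (\<Prod>i<length ks. \<eta>s ! i ^ (ms ! i)) / (\<Prod>i<length ks. b (ms ! i) ^ (ks ! i))) =
    csum (\<lambda>n. inverse (b n)) m (zip \<eta>s ks)"
proof -
  have "csum (\<lambda>n. inverse (b n)) m (zip \<eta>s ks) =
    (\<Sum>ms\<in>dec_tuples m (length ks). \<Prod>i<length ks. \<eta>s ! i ^ (ms ! i) * inverse (b (ms ! i)) ^ (ks ! i))"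
    unfolding csum_def sum_dec_tuples_eq_iter_sum[symmetric]
    using assms by (intro sum.cong) (auto simp: letter_def)
  then show ?thesis
    by (simp add: prod.distrib power_inverse divide_inverse prod_inversef[symmetric] comp_def)
qed

text \<open>The words in the harmonic product of \<open>[(1, 1)]\<close> with a given word; solving for the one
  with the most leading letters \<open>(1, 1)\<close> removes such letters one at a time.\<close>

fun stuffle1 :: "(complex \<times> nat) list \<Rightarrow> (complex \<times> nat) list list" where
  "stuffle1 [] = [[(1, 1)]]"
| "stuffle1 (x # w) = ((1, 1) # x # w) # ((fst x, Suc (snd x)) # w) # map ((#) x) (stuffle1 w)"

text \<open>A letter is multiplicative in the pair (\<eta>, k), so two letters at the same index
  merge into one letter with the exponents added. The inner induction on \<open>N\<close> compares
  the increments of both sides; the increment of the product contains the product for the shorter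
  word, which the outer induction supplies.\<close>

lemma csum_mult_stuffle1:
  "csum a N [(1, 1)] * csum a N w = sum_list (map (csum a N) (stuffle1 w))"
proof (induction w arbitrary: N)
  case Nil
  then show ?case by simp
next
  case (Cons x w)
  have mono: "csum a N (x # w) = 0" if "N \<le> 1" for N x w
    using that by (simp add: csum_Cons)
  have sl: "sum_list (map (csum a (Suc N) \<circ> (#) x) W) =
     sum_list (map (csum a N \<circ> (#) x) W) + letter a x N * sum_list (map (csum a N) W)"
    if "N \<ge> 1" for N W
    using that by (induction W) (auto simp: csum_Cons_Suc algebra_simps)
  have z: "sum_list (map (csum a N \<circ> (#) x) W) = 0" if "N \<le> 1" for N W
    using that by (induction W) (auto simp: mono)
  show ?case
  proof (induction N)
    case 0
    then show ?case by (simp add: mono z)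
  next
    case (Suc N)
    show ?case
    proof (cases "N = 0")
      case True
      then show ?thesis by (simp add: mono z)
    next
      case False
      then have N: "N \<ge> 1" by simp
      have "letter a (1, 1) N = a N" "letter a (fst x, Suc (snd x)) N = a N * letter a x N"
        by (auto simp: letter_def)
      then show ?thesis
        using Suc.IH N Cons.IH[of N] by (simp add: csum_Cons_Suc sl algebra_simps)
    qed
  qed
qed

text \<open>This is the number of divergent letters in front, the quantity on which the elimination
  of (1, 1) descends.\<close>

definition lead :: "(complex \<times> nat) list \<Rightarrow> nat" where
  "lead w = length (takeWhile (\<lambda>x. x = (1, 1)) w)"

lemma lead_simps [simp]:
  "lead [] = 0" "lead ((1, Suc 0) # w) = Suc (lead w)" "x \<noteq> (1, 1) \<Longrightarrow> lead (x # w) = 0"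
  by (auto simp: lead_def)

definition weight :: "(complex \<times> nat) list \<Rightarrow> nat" where
  "weight w = sum_list (map snd w)"

lemma weight_simps [simp]: "weight [] = 0" "weight (x # w) = snd x + weight w"
  by (auto simp: weight_def)

definition index_word :: "(complex \<times> nat) list \<Rightarrow> bool" where
  "index_word w \<longleftrightarrow> (\<forall>x\<in>set w. norm (fst x) = 1 \<and> snd x > 0)"

lemma index_word_simps [simp]:
  "index_word []" "index_word (x # w) \<longleftrightarrow> norm (fst x) = 1 \<and> snd x > 0 \<and> index_word w"
  by (auto simp: index_word_def)

lemma length_le_weight: "index_word w \<Longrightarrow> length w \<le> weight w"
  by (induction w) auto

lemma stuffle1_weight_index:
  "index_word w \<Longrightarrow> w' \<in> set (stuffle1 w) \<Longrightarrow> index_word w' \<and> weight w' = Suc (weight w)"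
  by (induction w arbitrary: w') auto

text \<open>Inserting (1, 1) at any of the \<open>Suc (lead w)\<close> places before, inside or just
  behind the leading run yields the same word \<open>(1, 1) # w\<close>. Every other product word
  inserts it later, or merges it with a letter into one of exponent at least 2, and so has no longer
  run. Quantifying over \<open>f\<close> expresses an identity of multisets of words without
  choosing an order.\<close>

lemma stuffle1_lead:
  assumes "index_word w"
  shows "\<exists>R. (\<forall>f :: _ \<Rightarrow> complex. sum_list (map f (stuffle1 w)) =
        of_nat (Suc (lead w)) * f ((1, 1) # w) + sum_list (map f R)) \<and>
      (\<forall>w'\<in>set R. lead w' \<le> lead w \<and> index_word w' \<and> weight w' = Suc (weight w))"
  using assms
proof (induction w)
  case Nil
  show ?case by (rule exI[of _ "[]"]) simp
next
  case (Cons x w)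
  show ?case
  proof (cases "x = (1, 1)")
    case False
    let ?R = "((fst x, Suc (snd x)) # w) # map ((#) x) (stuffle1 w)"
    have "lead w' = 0" if "w' \<in> set ?R" for w'
      using that False Cons.prems by auto
    moreover have "index_word w' \<and> weight w' = Suc (weight (x # w))" if "w' \<in> set ?R" for w'
      using stuffle1_weight_index[OF Cons.prems, of w'] that by auto
    ultimately show ?thesis using False by (intro exI[of _ ?R]) simp
  next
    case True
    from Cons obtain R where R:
      "\<And>f :: _ \<Rightarrow> complex. sum_list (map f (stuffle1 w)) =
        of_nat (Suc (lead w)) * f ((1, 1) # w) + sum_list (map f R)"
      "\<And>w'. w' \<in> set R \<Longrightarrow> lead w' \<le> lead w \<and> index_word w' \<and> weight w' = Suc (weight w)"
      by auto
    let ?R = "((1, 2) # w) # map ((#) x) R"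
    have "sum_list (map f (stuffle1 (x # w))) =
        of_nat (Suc (lead (x # w))) * f ((1, 1) # x # w) + sum_list (map f ?R)" for f :: "_ \<Rightarrow> complex"
      using R(1)[of "f \<circ> (#) x"] True by (simp add: algebra_simps numeral_2_eq_2)
    moreover have "lead w' \<le> lead (x # w) \<and> index_word w' \<and> weight w' = Suc (weight (x # w))"
      if "w' \<in> set ?R" for w'
      using that R(2) True Cons.prems by auto
    ultimately show ?thesis by blast
  qed
qed

section \<open>Perturbations of the harmonic coefficients\<close>

text \<open>\<open>d\<close> is a relative error: this form is stable under products up to a constant factor.\<close>

definition rel_close :: "real \<Rightarrow> real \<Rightarrow> complex \<Rightarrow> complex \<Rightarrow> bool" where
  "rel_close d X x y \<longleftrightarrow> norm x \<le> X \<and> norm y \<le> X \<and> norm (x - y) \<le> d * X"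

lemma rel_close_nonneg: "rel_close d X x y \<Longrightarrow> 0 \<le> X"
  unfolding rel_close_def using norm_ge_zero order_trans by blast

lemma rel_close_mono:
  assumes "rel_close d X x y" "d \<le> d'" "X \<le> X'" "0 \<le> d'"
  shows "rel_close d' X' x y"
proof -
  have "d * X \<le> d' * X'"
    using assms rel_close_nonneg[OF assms(1)] by (meson mult_left_mono mult_right_mono order_trans)
  then show ?thesis using assms unfolding rel_close_def by linarith
qed

lemma rel_close_mult:
  assumes "rel_close d X x x'" "rel_close d Y y y'" "0 \<le> d"
  shows "rel_close d (2 * X * Y) (x * y) (x' * y')"
proof -
  have XY: "0 \<le> X" "0 \<le> Y" using assms rel_close_nonneg by auto
  have *: "norm (u * v) \<le> X * Y" if "norm u \<le> X" "norm v \<le> Y" for u v :: complex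
    using that XY by (auto simp: norm_mult intro!: mult_mono)
  have "x * y - x' * y' = (x - x') * y + x' * (y - y')" by (simp add: algebra_simps)
  then have "norm (x * y - x' * y') \<le> norm (x - x') * norm y + norm x' * norm (y - y')"
    by (metis norm_mult norm_triangle_ineq)
  also have "\<dots> \<le> (d * X) * Y + X * (d * Y)"
    using assms XY by (intro add_mono mult_mono) (auto simp: rel_close_def)
  finally have "norm (x * y - x' * y') \<le> d * (2 * X * Y)" by (simp add: algebra_simps)
  moreover have "X * Y \<le> 2 * X * Y" using XY by simp
  ultimately show ?thesis
    using *[of x y] *[of x' y'] assms unfolding rel_close_def by (intro conjI) linarith+
qed

lemma rel_close_add:
  assumes "rel_close d X x x'" "rel_close d Y y y'"
  shows "rel_close d (X + Y) (x + y) (x' + y')"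
proof -
  have "norm (x + y - (x' + y')) \<le> norm (x - x') + norm (y - y')"
    by (metis add_diff_add norm_triangle_ineq)
  then show ?thesis using assms norm_triangle_ineq[of x y] norm_triangle_ineq[of x' y']
    unfolding rel_close_def by (auto simp: algebra_simps)
qed

lemma rel_close_scale: "rel_close d X x y \<Longrightarrow> norm u = 1 \<Longrightarrow> rel_close d X (u * x) (u * y)"
  by (auto simp: rel_close_def norm_mult right_diff_distrib[symmetric])

lemma rel_close_power: "rel_close d X x y \<Longrightarrow> 0 \<le> d \<Longrightarrow> rel_close d ((2 * X) ^ k) (x ^ k) (y ^ k)"
proof (induction k)
  case 0
  then show ?case by (simp add: rel_close_def)
next
  case (Suc k)
  then show ?case using rel_close_mult[of d X x y "(2 * X) ^ k" "x ^ k" "y ^ k"] by simp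
qed

lemma rel_close_sum:
  assumes "\<And>n. n \<in> A \<Longrightarrow> rel_close d (X n) (f n) (g n)"
  shows "rel_close d (\<Sum>n\<in>A. X n) (\<Sum>n\<in>A. f n) (\<Sum>n\<in>A. g n)"
proof -
  have "norm (\<Sum>n\<in>A. f n - g n) \<le> (\<Sum>n\<in>A. d * X n)"
    using assms by (intro sum_norm_le) (auto simp: rel_close_def)
  then show ?thesis using assms unfolding rel_close_def
    by (auto simp: sum_subtractf sum_distrib_left intro!: sum_norm_le)
qed

section \<open>Coefficients close to 1 / n and the sums built from them\<close>

definition inv_nat :: "nat \<Rightarrow> complex" where "inv_nat n = 1 / of_nat n"

text \<open>In the application \<open>e\<close> is a constant over m. The relative error
  \<open>e * n\<close> grows with n, in the same way for the coefficients and for their first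
  differences, whose natural size is 1 / n^2; the differences are there for summation by
  parts.\<close>

definition perturbed_inv :: "real \<Rightarrow> real \<Rightarrow> nat \<Rightarrow> (nat \<Rightarrow> complex) \<Rightarrow> bool" where
  "perturbed_inv e C N a \<longleftrightarrow> 0 \<le> e \<and> 1 \<le> C \<and>
     (\<forall>n\<in>{1..N}. rel_close (e * n) (C / n) (a n) (inv_nat n)) \<and>
     (\<forall>n\<in>{1..<N}. rel_close (e * n) (C / real n ^ 2) (a (Suc n) - a n) (inv_nat (Suc n) - inv_nat n))"

lemma perturbed_inv_mono: "perturbed_inv e C N a \<Longrightarrow> N' \<le> N \<Longrightarrow> perturbed_inv e C N' a"
  by (auto simp: perturbed_inv_def)

lemma harm_ge_1: "n \<ge> 1 \<Longrightarrow> (harm n :: real) \<ge> 1"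
  using harm_mono[of 1 n, where 'a = real] by (simp add: harm_def)

lemma sum_inverse_le_harm: "(\<Sum>n\<in>{1..<N}. 1 / real n) \<le> harm N"
  unfolding harm_def inverse_eq_divide by (intro sum_mono2) auto

lemma inv_nat_diff: "n \<ge> 1 \<Longrightarrow> inv_nat (Suc n) - inv_nat n = - 1 / (of_nat n * of_nat (Suc n))"
  by (simp add: inv_nat_def field_simps del: of_nat_Suc) (simp add: algebra_simps)

text \<open>With error 0 the harmonic coefficients are a perturbation of themselves. Estimates
  proved for all perturbations thereby also bound the unperturbed terms.\<close>

lemma perturbed_inv_inv_nat:
  assumes "1 \<le> C"
  shows "perturbed_inv 0 C N inv_nat"
  unfolding perturbed_inv_def
proof (intro conjI ballI)
  fix n assume "n \<in> {1..<N}"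
  then have "norm (inv_nat (Suc n) - inv_nat n) \<le> 1 / real n ^ 2"
    by (subst inv_nat_diff)
       (auto simp: norm_divide norm_mult power2_eq_square simp del: of_nat_Suc intro!: divide_left_mono mult_mono)
  also have "\<dots> \<le> C / real n ^ 2" using assms by (simp add: divide_right_mono)
  finally show "rel_close (0 * real n) (C / real n ^ 2) (inv_nat (Suc n) - inv_nat n) (inv_nat (Suc n) - inv_nat n)"
    by (simp add: rel_close_def)
qed (use assms in \<open>auto simp: rel_close_def inv_nat_def norm_divide divide_right_mono\<close>)

lemma letter_close:
  assumes "perturbed_inv e C N a" "n \<in> {1..N}" "norm (fst x) = 1"
  shows "rel_close (e * n) ((2 * C) ^ snd x / real n ^ snd x) (letter a x n) (letter inv_nat x n)"
proof -
  have "rel_close (e * n) ((2 * (C / n)) ^ snd x) (a n ^ snd x) (inv_nat n ^ snd x)"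
    by (rule rel_close_power) (use assms in \<open>auto simp: perturbed_inv_def\<close>)
  from rel_close_scale[OF this, of "fst x ^ n"] assms(3) show ?thesis
    by (simp add: letter_def norm_power power_divide power_mult_distrib)
qed

text \<open>Each letter is O(1 / n) and costs one factor \<open>harm N\<close>. For \<open>N\<close>
  of order m the relative error \<open>e * N\<close> is not small, so this gives no limit by itself;
  it is used for the inner sums, where an outer factor of order 1 / n^2 compensates. The constant
  \<open>K\<close> is independent of \<open>e\<close>, \<open>a\<close> and
  \<open>N\<close>.\<close>

lemma csum_close:
  assumes "index_word w" "1 \<le> C"
  shows "\<exists>K\<ge>0. \<forall>e a N. perturbed_inv e C N a \<longrightarrow>
    rel_close (e * N) (K * harm N ^ length w) (csum a N w) (csum inv_nat N w)"
  using assms(1)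
proof (induction w)
  case Nil
  show ?case by (rule exI[of _ 1]) (auto simp: rel_close_def perturbed_inv_def)
next
  case (Cons x w)
  then obtain K where K: "K \<ge> 0" "\<And>e a N. perturbed_inv e C N a \<Longrightarrow>
    rel_close (e * N) (K * harm N ^ length w) (csum a N w) (csum inv_nat N w)"
    by auto
  let ?K = "2 * (2 * C) ^ snd x * K"
  show ?case
  proof (intro exI[of _ ?K] conjI allI impI)
    show "?K \<ge> 0" using K(1) assms(2) by simp
  next
    fix e a N assume M: "perturbed_inv e C N a"
    have e: "e \<ge> 0" using M by (simp add: perturbed_inv_def)
    have "rel_close (e * N) (?K * harm N ^ length w * (1 / n)) (letter a x n * csum a n w)
       (letter inv_nat x n * csum inv_nat n w)" if n: "n \<in> {1..<N}" for n
    proof -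
      have "rel_close (e * n) (2 * ((2 * C) ^ snd x / real n ^ snd x) * (K * harm n ^ length w))
         (letter a x n * csum a n w) (letter inv_nat x n * csum inv_nat n w)"
        using n M Cons.prems e by (intro rel_close_mult letter_close[of e C N] K perturbed_inv_mono[OF M]) auto
      then show ?thesis
      proof (rule rel_close_mono)
        have "real n ^ 1 \<le> real n ^ snd x"
          using n Cons.prems by (intro power_increasing) auto
        then have "(2 * C) ^ snd x / real n ^ snd x \<le> (2 * C) ^ snd x / n"
          using n assms(2) by (intro divide_left_mono) auto
        then have "2 * ((2 * C) ^ snd x / real n ^ snd x) * (K * harm n ^ length w) \<le>
            2 * ((2 * C) ^ snd x / n) * (K * harm N ^ length w)"
          using n assms(2) K(1) harm_mono[of n N, where 'a = real]
          by (intro mult_mono power_mono) (auto simp: harm_nonneg)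
        then show "2 * ((2 * C) ^ snd x / real n ^ snd x) * (K * harm n ^ length w) \<le>
           ?K * harm N ^ length w * (1 / n)" by (simp add: mult_ac)
      qed (use e n in \<open>auto intro!: mult_left_mono\<close>)
    qed
    from rel_close_sum[OF this, where A = "{1..<N}"]
    have "rel_close (e * N) (\<Sum>n\<in>{1..<N}. ?K * harm N ^ length w * (1 / n))
      (csum a N (x # w)) (csum inv_nat N (x # w))"
      by (simp add: csum_Cons)
    then show "rel_close (e * N) (?K * harm N ^ length (x # w)) (csum a N (x # w)) (csum inv_nat N (x # w))"
    proof (rule rel_close_mono)
      have "(\<Sum>n\<in>{1..<N}. ?K * harm N ^ length w * (1 / n)) =
         ?K * harm N ^ length w * (\<Sum>n\<in>{1..<N}. 1 / n)"
        by (simp add: sum_distrib_left)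
      also have "\<dots> \<le> ?K * harm N ^ length w * harm N"
        using sum_inverse_le_harm K(1) assms(2) by (intro mult_left_mono) (auto simp: harm_nonneg)
      finally show "(\<Sum>n\<in>{1..<N}. ?K * harm N ^ length w * (1 / n)) \<le> ?K * harm N ^ length (x # w)"
        by (simp add: mult_ac)
    qed (use e in auto)
  qed
qed

text \<open>The inner sum stops at n, so the error at each term is \<open>e * n\<close> and not the
  cruder \<open>e * N\<close>; this dependence on n is what later leaves only a harmonic
  sum.\<close>

lemma letter_csum_close:
  assumes "index_word (x # w)" "1 \<le> C"
  shows "\<exists>K\<ge>0. \<forall>e a N. perturbed_inv e C N a \<longrightarrow> (\<forall>n\<in>{1..N}.
    rel_close (e * n) (K * harm n ^ length w / real n ^ snd x)
      (letter a x n * csum a n w) (letter inv_nat x n * csum inv_nat n w))"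
proof -
  obtain K where K: "K \<ge> 0" "\<And>e a N. perturbed_inv e C N a \<Longrightarrow>
    rel_close (e * N) (K * harm N ^ length w) (csum a N w) (csum inv_nat N w)"
    using csum_close[of w C] assms by auto
  show ?thesis
  proof (intro exI[of _ "2 * (2 * C) ^ snd x * K"] conjI allI impI ballI)
    fix e a N n assume M: "perturbed_inv e C N a" and n: "n \<in> {1..N}"
    have "rel_close (e * n) (2 * ((2 * C) ^ snd x / real n ^ snd x) * (K * harm n ^ length w))
         (letter a x n * csum a n w) (letter inv_nat x n * csum inv_nat n w)"
      using n M assms by (intro rel_close_mult letter_close[of e C N] K perturbed_inv_mono[OF M]) (auto simp: perturbed_inv_def)
    then show "rel_close (e * n) (2 * (2 * C) ^ snd x * K * harm n ^ length w / real n ^ snd x)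
         (letter a x n * csum a n w) (letter inv_nat x n * csum inv_nat n w)"
      by (simp add: mult_ac)
  qed (use K assms in auto)
qed

text \<open>Raising the bound by one adds a single term, the one whose largest index is n, and for
  the empty word it adds nothing.\<close>

lemma csum_diff_close:
  assumes "index_word w" "1 \<le> C"
  shows "\<exists>K\<ge>0. \<forall>e a N. perturbed_inv e C N a \<longrightarrow> (\<forall>n\<in>{1..N}.
    rel_close (e * n) (K * harm n ^ length w / n)
      (csum a (Suc n) w - csum a n w) (csum inv_nat (Suc n) w - csum inv_nat n w))"
proof (cases w)
  case Nil
  then show ?thesis by (intro exI[of _ 0]) (auto simp: rel_close_def)
next
  case (Cons x u)
  obtain K where K: "K \<ge> 0" "\<And>e a N n. perturbed_inv e C N a \<Longrightarrow> n \<in> {1..N} \<Longrightarrow>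
    rel_close (e * n) (K * harm n ^ length u / real n ^ snd x)
      (letter a x n * csum a n u) (letter inv_nat x n * csum inv_nat n u)"
    using letter_csum_close[of x u C] assms Cons by blast
  show ?thesis
  proof (intro exI[of _ K] conjI allI impI ballI)
    fix e a N n assume M: "perturbed_inv e C N a" and n: "n \<in> {1..N}"
    have "real n ^ 1 \<le> real n ^ snd x"
      using n assms Cons by (intro power_increasing) auto
    then have "K * harm n ^ length u / real n ^ snd x \<le> K * harm n ^ length u / n ^ 1"
      using n K(1) by (intro divide_left_mono) (auto simp: harm_nonneg)
    also have "\<dots> \<le> K * harm n ^ length w / n ^ 1"
      using n K(1) Cons harm_ge_1[of n] by (intro divide_right_mono mult_left_mono power_increasing) auto
    finally have "K * harm n ^ length u / real n ^ snd x \<le> K * harm n ^ length w / n" by simp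
    then show "rel_close (e * n) (K * harm n ^ length w / n)
      (csum a (Suc n) w - csum a n w) (csum inv_nat (Suc n) w - csum inv_nat n w)"
      using rel_close_mono[OF K(2)[OF M n]] n M Cons by (simp add: csum_Cons_Suc perturbed_inv_def)
  qed (use K in auto)
qed

section \<open>Tails of sums of log^r n / n^2, and limits with explicit rates\<close>

lemma inverse_square_le_diff:
  assumes "n \<ge> 1"
  shows "1 / real n ^ 2 \<le> 2 * (1 / n - 1 / Suc n)"
proof -
  have "1 / real n - 1 / Suc n = 1 / (n * Suc n)"
    using assms by (simp add: field_simps)
  moreover have "2 / (2 * real n ^ 2) \<le> 2 / (n * Suc n)"
  proof (rule frac_le)
    have "real n * 1 \<le> real n * n" using assms by (intro mult_left_mono) auto
    then show "real (n * Suc n) \<le> 2 * real n ^ 2" by (simp add: power2_eq_square)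
  qed (use assms in \<open>auto intro!: add_pos_nonneg\<close>)
  ultimately show ?thesis by simp
qed

lemma sum_le_telescope:
  fixes f g k :: "nat \<Rightarrow> real"
  assumes "N \<le> N'" "\<And>n. n \<ge> N \<Longrightarrow> f n \<le> c * (g n - g (Suc n)) + k n"
  shows "(\<Sum>n\<in>{N..<N'}. f n) \<le> c * (g N - g N') + (\<Sum>n\<in>{N..<N'}. k n)"
  using assms(1)
proof (induction N' rule: dec_induct)
  case (step n)
  then show ?case using assms(2)[of n] by (simp add: algebra_simps)
qed simp

text \<open>Discrete integration by parts: harm^(r+1) / n^2 is at most twice the decrease of
  harm^(r+1) / n plus a correction for the growth of harm^(r+1). That growth has order harm^r / n,
  so the correction is a sum of the same kind with exponent r, and the induction on the exponent
  closes.\<close>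

lemma harm_power_tail:
  "\<exists>K\<ge>0. \<forall>N\<ge>1. \<forall>N'\<ge>N. (\<Sum>n\<in>{N..<N'}. harm n ^ r / real n ^ 2) \<le> K * (harm N ^ r / N)"
proof (induction r)
  case 0
  have "(\<Sum>n\<in>{N..<N'}. 1 / real n ^ 2) \<le> 2 * (1 / N)" if "1 \<le> N" "N \<le> N'" for N N'
  proof -
    have "(\<Sum>n\<in>{N..<N'}. 1 / real n ^ 2) \<le> 2 * (1 / N - 1 / N') + (\<Sum>n\<in>{N..<N'}. 0)"
      using that(1) inverse_square_le_diff by (intro sum_le_telescope that(2)) simp
    also have "\<dots> \<le> 2 * (1 / N)" by simp
    finally show ?thesis .
  qed
  then show ?case by (intro exI[of _ 2]) auto
next
  case (Suc r)
  then obtain K where K: "K \<ge> 0" "\<And>N N'. N \<ge> 1 \<Longrightarrow> N' \<ge> N \<Longrightarrow>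
    (\<Sum>n\<in>{N..<N'}. harm n ^ r / real n ^ 2) \<le> K * (harm N ^ r / N)" by auto
  \<comment> \<open>\<open>?D\<close> is the 2 of the telescoping bound times the constant in
    h'^(r+1) - h^(r+1) \<le> (h' - h) (r+1) (2 h)^r, where h' \<le> 2 h because 1 / (n+1) \<le> 1
    \<le> h.\<close>
  let ?D = "2 * real (Suc r) * 2 ^ r :: real"
  have step: "harm n ^ Suc r / real n ^ 2 \<le>
     2 * (harm n ^ Suc r / n - harm (Suc n) ^ Suc r / Suc n) + ?D * (harm n ^ r / real n ^ 2)"
    if n: "n \<ge> 1" for n
  proof -
    define h h' :: real where "h = harm n" and "h' = harm (Suc n)"
    have h: "h \<ge> 1" using harm_ge_1[OF n] by (simp add: h_def)
    have h': "h' = h + 1 / Suc n" by (simp add: h_def h'_def harm_Suc divide_inverse)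
    have "1 / real (Suc n) \<le> 1" by simp
    moreover have "1 / real (Suc n) \<ge> 0" by simp
    ultimately have h'2: "h' \<le> 2 * h" "h \<le> h'" "0 \<le> h'"
      using h unfolding h' by linarith+
    have "(\<Sum>i<Suc r. h' ^ i * h ^ (r - i)) \<le> (\<Sum>i<Suc r. h' ^ r)"
    proof (rule sum_mono)
      fix i assume "i \<in> {..<Suc r}"
      then have "h' ^ i * h ^ (r - i) \<le> h' ^ i * h' ^ (r - i)"
        using h h'2 by (intro mult_left_mono power_mono) auto
      also have "\<dots> = h' ^ r" using \<open>i \<in> _\<close> by (simp flip: power_add)
      finally show "h' ^ i * h ^ (r - i) \<le> h' ^ r" .
    qed
    also have "(\<Sum>i<Suc r. h' ^ r) \<le> real (Suc r) * (2 * h) ^ r"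
      unfolding sum_constant card_lessThan using h'2 by (intro mult_left_mono power_mono) auto
    finally have "(h' - h) * (\<Sum>i<Suc r. h' ^ i * h ^ (r - i)) \<le> (h' - h) * (real (Suc r) * (2 * h) ^ r)"
      using h'2 by (intro mult_left_mono) auto
    moreover have "h' ^ Suc r - h ^ Suc r = (h' - h) * (\<Sum>i<Suc r. h' ^ i * h ^ (r - i))"
      using power_diff_sumr2[of h' "Suc r" h] by (simp add: mult_ac)
    moreover have "h' - h = 1 / Suc n" using h' by simp
    ultimately have "h' ^ Suc r - h ^ Suc r \<le> (1 / Suc n) * (real (Suc r) * (2 * h) ^ r)"
      by metis
    then have "(h' ^ Suc r - h ^ Suc r) * (1 / Suc n) \<le> (1 / Suc n) * (real (Suc r) * (2 * h) ^ r) * (1 / Suc n)"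
      by (rule mult_right_mono) simp
    also have "\<dots> = (real (Suc r) * 2 ^ r * h ^ r) / real (Suc n) ^ 2"
      by (simp add: power_mult_distrib power2_eq_square del: of_nat_Suc)
    also have "\<dots> \<le> (real (Suc r) * 2 ^ r * h ^ r) / real n ^ 2"
      using n h by (intro divide_left_mono power_mono mult_nonneg_nonneg) auto
    finally have "2 * ((h' ^ Suc r - h ^ Suc r) * (1 / Suc n)) \<le> 2 * ((real (Suc r) * 2 ^ r * h ^ r) / real n ^ 2)"
      by (rule mult_left_mono) simp
    also have "\<dots> = ?D * (h ^ r / real n ^ 2)" by simp
    finally have 1: "2 * ((h' ^ Suc r - h ^ Suc r) * (1 / Suc n)) \<le> ?D * (h ^ r / real n ^ 2)" .
    have "h ^ Suc r * (1 / real n ^ 2) \<le> h ^ Suc r * (2 * (1 / n - 1 / Suc n))"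
      using inverse_square_le_diff[OF n] h by (intro mult_left_mono) auto
    also have "\<dots> = 2 * (h ^ Suc r / n - h' ^ Suc r / Suc n) + 2 * ((h' ^ Suc r - h ^ Suc r) * (1 / Suc n))"
      by (simp add: algebra_simps diff_divide_distrib del: power_Suc of_nat_Suc)
    finally show ?thesis using 1 by (simp add: h_def h'_def del: power_Suc of_nat_Suc)
  qed
  show ?case
  proof (intro exI[of _ "2 + ?D * K"] conjI allI impI)
    fix N N' :: nat assume N: "1 \<le> N" "N \<le> N'"
    let ?h = "harm N :: real"
    have "(\<Sum>n\<in>{N..<N'}. harm n ^ Suc r / real n ^ 2) \<le>
      2 * (?h ^ Suc r / N - harm N' ^ Suc r / N') + (\<Sum>n\<in>{N..<N'}. ?D * (harm n ^ r / real n ^ 2))"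
      using step N(1) by (intro sum_le_telescope N(2)) auto
    also have "\<dots> \<le> 2 * (?h ^ Suc r / N) + ?D * (K * (?h ^ r / N))"
      unfolding sum_distrib_left[symmetric]
      using K(2)[OF N] by (intro add_mono mult_left_mono) (auto simp: harm_nonneg)
    also have "\<dots> \<le> 2 * (?h ^ Suc r / N) + ?D * (K * (?h ^ Suc r / N))"
      using K(1) harm_ge_1[OF N(1)]
      by (intro add_mono mult_left_mono divide_right_mono power_increasing) auto
    finally show "(\<Sum>n\<in>{N..<N'}. harm n ^ Suc r / real n ^ 2) \<le> (2 + ?D * K) * (?h ^ Suc r / N)"
      by (simp add: algebra_simps del: power_Suc)
  qed (use K in auto)
qed

lemma harm_power_over_tendsto_0: "(\<lambda>N. harm N ^ r / real N) \<longlonglongrightarrow> 0"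
proof (rule Lim_null_comparison)
  show "\<forall>\<^sub>F N in sequentially. norm (harm N ^ r / real N) \<le> (1 + ln (real N)) ^ r / real N"
  proof (rule eventually_sequentiallyI)
    fix N :: nat assume "1 \<le> N"
    then have "(harm N :: real) \<le> 1 + ln (real N)"
      using euler_mascheroni_sequence_decreasing[of 1 N] by (simp add: harm_def)
    then show "norm (harm N ^ r / real N) \<le> (1 + ln (real N)) ^ r / real N"
      by (auto simp: harm_nonneg intro!: divide_right_mono power_mono)
  qed
  show "(\<lambda>N. (1 + ln (real N)) ^ r / real N) \<longlonglongrightarrow> 0"
    by real_asymp
qed

text \<open>The bound on differences makes the sequence Cauchy, and letting the larger index tend to
  infinity turns the same bound into a rate of convergence.\<close>

lemma cauchy_bound_limit:
  fixes f :: "nat \<Rightarrow> complex"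
  assumes "\<And>N N'. 1 \<le> N \<Longrightarrow> N \<le> N' \<Longrightarrow> norm (f N' - f N) \<le> B N" and "B \<longlonglongrightarrow> (0 :: real)"
  shows "\<exists>c. \<forall>N\<ge>1. norm (f N - c) \<le> B N"
proof -
  have "Cauchy f"
  proof (rule metric_CauchyI)
    fix e :: real assume "e > 0"
    from assms(2) have "\<forall>\<^sub>F N in sequentially. B N < e / 2 \<and> N \<ge> 1"
      using \<open>e > 0\<close> by (intro eventually_conj order_tendstoD(2) eventually_ge_at_top) auto
    then obtain N where N: "B N < e / 2" "N \<ge> 1"
      unfolding eventually_sequentially by blast
    have "dist (f n) (f m) < e" if "n \<ge> N" "m \<ge> N" for m n
    proof -
      have "dist (f n) (f m) \<le> dist (f n) (f N) + dist (f m) (f N)" by (rule dist_triangle2)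
      also have "\<dots> < e" using assms(1)[OF N(2) that(1)] assms(1)[OF N(2) that(2)] N(1)
        by (simp add: dist_norm)
      finally show ?thesis .
    qed
    then show "\<exists>M. \<forall>m\<ge>M. \<forall>n\<ge>M. dist (f m) (f n) < e" by blast
  qed
  then obtain c where c: "f \<longlonglongrightarrow> c" using Cauchy_convergent convergent_def by blast
  have "norm (f N - c) \<le> B N" if "1 \<le> N" for N
  proof (rule tendsto_upperbound[where F = sequentially and f = "\<lambda>n. norm (f N - f n)"])
    show "(\<lambda>n. norm (f N - f n)) \<longlonglongrightarrow> norm (f N - c)" by (intro tendsto_intros c)
    show "\<forall>\<^sub>F n in sequentially. norm (f N - f n) \<le> B N"
      using assms(1)[OF that] by (intro eventually_sequentiallyI[of N]) (simp add: norm_minus_commute)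
  qed simp
  then show ?thesis by blast
qed

text \<open>Two errors are added. The perturbation contributes the sum of e n harm^l / n^2, which is
  at most e harm^(l+1); replacing the unperturbed partial sum by its limit costs a tail of order
  harm^l / N. The limit \<open>c\<close> is that of the unperturbed terms and hence the same for
  every perturbation.\<close>

lemma second_order_sum:
  assumes "\<And>n. 1 \<le> n \<Longrightarrow> norm (\<tau>' n) \<le> K0 * (harm n ^ l / real n ^ 2)" "K0 \<ge> 0"
  shows "\<exists>c. \<exists>K\<ge>0. \<forall>N\<ge>1. \<forall>e\<ge>0. \<forall>\<tau>.
    (\<forall>n\<in>{1..<N}. rel_close (e * n) (K0 * (harm n ^ l / real n ^ 2)) (\<tau> n) (\<tau>' n)) \<longrightarrow>
    norm ((\<Sum>n\<in>{1..<N}. \<tau> n) - c) \<le> K * ((e + 1 / N) * harm N ^ Suc l)"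
proof -
  obtain K where K: "K \<ge> 0" "\<And>N N'. N \<ge> 1 \<Longrightarrow> N' \<ge> N \<Longrightarrow>
    (\<Sum>n\<in>{N..<N'}. harm n ^ l / real n ^ 2) \<le> K * (harm N ^ l / N)"
    using harm_power_tail[of l] by blast
  define f where "f N = (\<Sum>n\<in>{1..<N}. \<tau>' n)" for N
  have "norm (f N' - f N) \<le> K0 * K * (harm N ^ l / N)" if "1 \<le> N" "N \<le> N'" for N N'
  proof -
    have "f N' - f N = (\<Sum>n\<in>{N..<N'}. \<tau>' n)"
      unfolding f_def using sum.atLeastLessThan_concat[OF that, of \<tau>'] by (simp add: algebra_simps)
    also have "norm \<dots> \<le> (\<Sum>n\<in>{N..<N'}. K0 * (harm n ^ l / real n ^ 2))"
      using assms(1) that(1) by (intro sum_norm_le) auto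
    also have "\<dots> \<le> K0 * (K * (harm N ^ l / N))"
      unfolding sum_distrib_left[symmetric] using K(2)[OF that] assms(2) by (intro mult_left_mono)
    finally show ?thesis by simp
  qed
  moreover have "(\<lambda>N. K0 * K * (harm N ^ l / real N)) \<longlonglongrightarrow> 0"
    using tendsto_mult_left[OF harm_power_over_tendsto_0, of "K0 * K"] by simp
  ultimately have "\<exists>c. \<forall>N\<ge>1. norm (f N - c) \<le> K0 * K * (harm N ^ l / N)"
    by (rule cauchy_bound_limit)
  then obtain c where c: "\<And>N. 1 \<le> N \<Longrightarrow> norm (f N - c) \<le> K0 * K * (harm N ^ l / N)"
    by blast
  show ?thesis
  proof (rule exI[of _ c], rule exI[of _ "K0 + K0 * K"], intro conjI allI impI)
    fix N :: nat and e :: real and \<tau>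
    assume N: "1 \<le> N" and e: "0 \<le> e" and
      \<tau>: "\<forall>n\<in>{1..<N}. rel_close (e * n) (K0 * (harm n ^ l / real n ^ 2)) (\<tau> n) (\<tau>' n)"
    have "norm ((\<Sum>n\<in>{1..<N}. \<tau> n) - f N) \<le> (\<Sum>n\<in>{1..<N}. e * K0 * harm N ^ l * (1 / n))"
      unfolding f_def sum_subtractf[symmetric]
    proof (rule sum_norm_le)
      fix n assume n: "n \<in> {1..<N}"
      have "norm (\<tau> n - \<tau>' n) \<le> (e * n) * (K0 * (harm n ^ l / real n ^ 2))"
        using \<tau> n by (auto simp: rel_close_def)
      also have "\<dots> = e * K0 * harm n ^ l * (1 / n)"
        using n by (simp add: power2_eq_square)
      also have "\<dots> \<le> e * K0 * harm N ^ l * (1 / n)"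
        using n e assms(2) harm_mono[of n N, where 'a = real]
        by (intro mult_right_mono mult_left_mono power_mono) (auto simp: harm_nonneg)
      finally show "norm (\<tau> n - \<tau>' n) \<le> e * K0 * harm N ^ l * (1 / n)" .
    qed
    also have "\<dots> \<le> e * K0 * harm N ^ l * harm N"
      unfolding sum_distrib_left[symmetric] using sum_inverse_le_harm e assms(2)
      by (intro mult_left_mono) (auto simp: harm_nonneg)
    finally have 1: "norm ((\<Sum>n\<in>{1..<N}. \<tau> n) - f N) \<le> K0 * (e * harm N ^ Suc l)" by (simp add: mult_ac)
    have "K0 * K * (harm N ^ l / N) \<le> K0 * K * (harm N ^ Suc l / N)"
      using harm_ge_1[OF N] assms(2) K(1) by (intro mult_left_mono divide_right_mono power_increasing) auto
    then have "norm ((\<Sum>n\<in>{1..<N}. \<tau> n) - c) \<le> K0 * (e * harm N ^ Suc l) + K0 * K * (harm N ^ Suc l / N)"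
      using 1 c[OF N] norm_triangle_ineq[of "(\<Sum>n\<in>{1..<N}. \<tau> n) - f N" "f N - c"] by simp
    also have "\<dots> \<le> (K0 + K0 * K) * (e * harm N ^ Suc l) + (K0 + K0 * K) * (harm N ^ Suc l / N)"
      using assms(2) K(1) e by (intro add_mono mult_right_mono) (auto simp: harm_nonneg)
    finally show "norm ((\<Sum>n\<in>{1..<N}. \<tau> n) - c) \<le> (K0 + K0 * K) * ((e + 1 / N) * harm N ^ Suc l)"
      by (simp add: algebra_simps)
  qed (use assms(2) K in auto)
qed

lemma abel_summation:
  fixes z :: complex
  assumes "N \<ge> 1"
  shows "(z - 1) * (\<Sum>n\<in>{1..<N}. z ^ n * b n) =
    z ^ N * b N - z * b 1 - (\<Sum>n\<in>{1..<N}. z ^ Suc n * (b (Suc n) - b n))"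
  using assms by (induction N rule: dec_induct) (auto simp: algebra_simps)

text \<open>Summation by parts turns the leading letter \<open>(\<eta>, 1)\<close> with \<open>\<eta> \<noteq> 1\<close> into a sum of second
  order terms, as is already the case for a leading letter \<open>(\<eta>, k)\<close> with \<open>k \<ge> 2\<close>.\<close>

lemma csum_admissible:
  assumes w: "index_word (x # u)" and x: "x \<noteq> (1, 1)" and C: "1 \<le> C"
  shows "\<exists>c. \<exists>K\<ge>0. \<forall>e a N. N \<ge> 1 \<longrightarrow> perturbed_inv e C N a \<longrightarrow>
    norm (csum a N (x # u) - c) \<le> K * ((e + 1 / N) * harm N ^ Suc (length u))"
proof (cases "snd x = 1")
  case False
  with w have k: "snd x \<ge> 2" by auto
  obtain K0 where K0: "K0 \<ge> 0" "\<And>e a N n. perturbed_inv e C N a \<Longrightarrow> n \<in> {1..N} \<Longrightarrow>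
    rel_close (e * n) (K0 * harm n ^ length u / real n ^ snd x)
      (letter a x n * csum a n u) (letter inv_nat x n * csum inv_nat n u)"
    using letter_csum_close[OF w C] by blast
  have cl: "rel_close (e * n) (K0 * (harm n ^ length u / real n ^ 2))
      (letter a x n * csum a n u) (letter inv_nat x n * csum inv_nat n u)"
    if "perturbed_inv e C N a" "n \<in> {1..N}" for e a N n
  proof (rule rel_close_mono[OF K0(2)[OF that]])
    have "real n ^ 2 \<le> real n ^ snd x"
      using that(2) k by (intro power_increasing) auto
    then show "K0 * harm n ^ length u / real n ^ snd x \<le> K0 * (harm n ^ length u / real n ^ 2)"
      using that(2) K0(1) unfolding times_divide_eq_right by (intro divide_left_mono) (auto simp: harm_nonneg)
  qed (use that in \<open>auto simp: perturbed_inv_def\<close>)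
  have "norm (letter inv_nat x n * csum inv_nat n u) \<le> K0 * (harm n ^ length u / real n ^ 2)"
    if "1 \<le> n" for n
    using cl[OF perturbed_inv_inv_nat[OF C, of n], of n] that by (auto simp: rel_close_def)
  from second_order_sum[OF this K0(1)] obtain c K where K: "K \<ge> 0"
    "\<And>N e \<tau>. 1 \<le> N \<Longrightarrow> 0 \<le> e \<Longrightarrow>
    (\<forall>n\<in>{1..<N}. rel_close (e * n) (K0 * (harm n ^ length u / real n ^ 2)) (\<tau> n)
       (letter inv_nat x n * csum inv_nat n u)) \<Longrightarrow>
    norm ((\<Sum>n\<in>{1..<N}. \<tau> n) - c) \<le> K * ((e + 1 / N) * harm N ^ Suc (length u))"
    by blast
  show ?thesis
  proof (rule exI[of _ c], rule exI[of _ K], intro conjI allI impI)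
    fix e a N assume N: "1 \<le> N" and M: "perturbed_inv e C N a"
    show "norm (csum a N (x # u) - c) \<le> K * ((e + 1 / N) * harm N ^ Suc (length u))"
      unfolding csum_Cons using K(2)[OF N, of e] cl[OF M] M by (auto simp: perturbed_inv_def)
  qed (use K in auto)
next
  case True
  define \<eta> where "\<eta> = fst x"
  have \<eta>: "\<eta> \<noteq> 1" "norm \<eta> = 1" using x True w by (auto simp: \<eta>_def prod_eq_iff)
  have u: "index_word u" using w by simp
  define l where "l = length u"
  define b where "b a n = a n * csum a n u" for a :: "nat \<Rightarrow> complex" and n
  define d where "d a n = \<eta> ^ Suc n * (b a (Suc n) - b a n)" for a :: "nat \<Rightarrow> complex" and n
  obtain K1 where K1: "K1 \<ge> 0" "\<And>e a N. perturbed_inv e C N a \<Longrightarrow>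
    rel_close (e * N) (K1 * harm N ^ l) (csum a N u) (csum inv_nat N u)"
    using csum_close[OF u C] unfolding l_def by blast
  obtain K2 where K2: "K2 \<ge> 0" "\<And>e a N n. perturbed_inv e C N a \<Longrightarrow> n \<in> {1..N} \<Longrightarrow>
    rel_close (e * n) (K2 * harm n ^ l / n)
      (csum a (Suc n) u - csum a n u) (csum inv_nat (Suc n) u - csum inv_nat n u)"
    using csum_diff_close[OF u C] unfolding l_def by blast
  \<comment> \<open>By the product rule, the difference of \<open>b\<close> is a difference of
    \<open>csum\<close> times a shifted coefficient, contributing \<open>4 * C * K2\<close>, plus a
    difference of coefficients times \<open>csum\<close>, contributing \<open>2 * C * K1\<close>.
    One factor 2 in each is that of \<open>rel_close_mult\<close>; the other one in the first
    absorbs the shift from n to n + 1.\<close>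
  define K0 where "K0 = 2 * C * K1 + 4 * C * K2"
  have K0: "K0 \<ge> 0" using K1 K2 C by (simp add: K0_def)
  have cb: "rel_close (e * n) (2 * C * K1 * (harm n ^ l / n)) (b a n) (b inv_nat n)"
    if M: "perturbed_inv e C N a" and n: "n \<in> {1..N}" for e a N n
  proof -
    have "rel_close (e * n) (2 * (C / n) * (K1 * harm n ^ l)) (b a n) (b inv_nat n)"
      unfolding b_def using M n
      by (intro rel_close_mult K1 perturbed_inv_mono[OF M]) (auto simp: perturbed_inv_def)
    then show ?thesis by (simp add: mult_ac)
  qed
  have cl: "rel_close (e * n) (K0 * (harm n ^ l / real n ^ 2)) (d a n) (d inv_nat n)"
    if M: "perturbed_inv e C N a" and n: "n \<in> {1..<N}" for e a N n
  proof -
    have e: "e \<ge> 0" using M by (simp add: perturbed_inv_def)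
    have "rel_close (e * Suc n) (C / Suc n) (a (Suc n)) (inv_nat (Suc n))"
      using M n by (auto simp: perturbed_inv_def simp del: of_nat_Suc)
    moreover have "e * Suc n * (C / Suc n) \<le> e * n * (2 * C / n)" "C / Suc n \<le> 2 * C / n"
      using e C n by (auto simp: field_simps)
    ultimately have "rel_close (e * n) (2 * C / n) (a (Suc n)) (inv_nat (Suc n))"
      unfolding rel_close_def by linarith
    then have "rel_close (e * n) (2 * (2 * C / n) * (K2 * harm n ^ l / n))
      (a (Suc n) * (csum a (Suc n) u - csum a n u))
      (inv_nat (Suc n) * (csum inv_nat (Suc n) u - csum inv_nat n u))"
      using n e by (intro rel_close_mult K2(2)[OF M]) auto
    moreover have "rel_close (e * n) (2 * (C / real n ^ 2) * (K1 * harm n ^ l))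
      ((a (Suc n) - a n) * csum a n u) ((inv_nat (Suc n) - inv_nat n) * csum inv_nat n u)"
      using n e M by (intro rel_close_mult K1 perturbed_inv_mono[OF M]) (auto simp: perturbed_inv_def)
    ultimately have "rel_close (e * n) (2 * (2 * C / n) * (K2 * harm n ^ l / n) + 2 * (C / real n ^ 2) * (K1 * harm n ^ l))
      (\<eta> ^ Suc n * (a (Suc n) * (csum a (Suc n) u - csum a n u) + (a (Suc n) - a n) * csum a n u))
      (\<eta> ^ Suc n * (inv_nat (Suc n) * (csum inv_nat (Suc n) u - csum inv_nat n u) + (inv_nat (Suc n) - inv_nat n) * csum inv_nat n u))"
      using \<eta>(2) by (intro rel_close_scale rel_close_add) (auto simp: norm_mult norm_power)
    then show ?thesis
      by (simp add: d_def b_def K0_def algebra_simps power2_eq_square add_divide_distrib)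
  qed
  have "norm (d inv_nat n) \<le> K0 * (harm n ^ l / real n ^ 2)"
    if "1 \<le> n" for n
    using cl[OF perturbed_inv_inv_nat[OF C, of "Suc n"], of n] that by (auto simp: rel_close_def)
  from second_order_sum[OF this K0] obtain c K where K: "K \<ge> 0"
    "\<And>N e \<tau>. 1 \<le> N \<Longrightarrow> 0 \<le> e \<Longrightarrow>
    (\<forall>n\<in>{1..<N}. rel_close (e * n) (K0 * (harm n ^ l / real n ^ 2)) (\<tau> n) (d inv_nat n)) \<Longrightarrow>
    norm ((\<Sum>n\<in>{1..<N}. \<tau> n) - c) \<le> K * ((e + 1 / N) * harm N ^ Suc l)"
    by blast
  \<comment> \<open>Here c' is the limit of the formula for summation by parts: the boundary term at
    \<open>N\<close> disappears, the one at 1 and the limit \<open>c\<close> of the difference sum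
    remain, and \<eta> - 1 \<noteq> 0 is divided out. In \<open>K'\<close> each of the two boundary
    terms contributes \<open>2 * C * K1\<close>.\<close>
  define c' where "c' = (- (\<eta> * b inv_nat 1) - c) / (\<eta> - 1)"
  define K' where "K' = (4 * C * K1 + K) / norm (\<eta> - 1)"
  show ?thesis
  proof (rule exI[of _ c'], rule exI[of _ K'], intro conjI allI impI)
    show "K' \<ge> 0" using K1(1) K(1) C by (simp add: K'_def)
    fix e a N assume N: "1 \<le> N" and M: "perturbed_inv e C N a"
    define B where "B = (e + 1 / N) * harm N ^ Suc l"
    have e: "e \<ge> 0" using M by (simp add: perturbed_inv_def)
    have hl: "1 \<le> (harm N :: real) ^ Suc l" using harm_ge_1[OF N] by (rule one_le_power)
    have hl': "(harm N :: real) ^ l \<le> harm N ^ Suc l"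
      using harm_ge_1[OF N] by (intro power_increasing) auto
    have CK: "0 \<le> 2 * C * K1" using K1 C by simp
    have "csum a N (x # u) = (\<Sum>n\<in>{1..<N}. \<eta> ^ n * b a n)"
      using True by (simp add: csum_Cons letter_def \<eta>_def b_def mult.assoc)
    then have "(\<eta> - 1) * csum a N (x # u) = \<eta> ^ N * b a N - \<eta> * b a 1 - (\<Sum>n\<in>{1..<N}. d a n)"
      using abel_summation[OF N, of \<eta> "b a"] by (simp add: d_def)
    moreover have "(\<eta> - 1) * c' = - (\<eta> * b inv_nat 1) - c" using \<eta>(1) by (simp add: c'_def)
    ultimately have "(\<eta> - 1) * (csum a N (x # u) - c') =
      \<eta> ^ N * b a N - \<eta> * (b a 1 - b inv_nat 1) - ((\<Sum>n\<in>{1..<N}. d a n) - c)"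
      by (simp add: algebra_simps)
    then have "norm (\<eta> - 1) * norm (csum a N (x # u) - c') \<le>
      norm (\<eta> ^ N * b a N) + norm (\<eta> * (b a 1 - b inv_nat 1)) + norm ((\<Sum>n\<in>{1..<N}. d a n) - c)"
      by (metis norm_mult norm_triangle_le_diff norm_triangle_ineq4 add_mono order_refl)
    moreover have "norm (\<eta> ^ N * b a N) \<le> 2 * C * K1 * B"
    proof -
      have "norm (b a N) \<le> 2 * C * K1 * (harm N ^ l / N)"
        using cb[OF M, of N] N by (auto simp: rel_close_def)
      also have "\<dots> \<le> 2 * C * K1 * B"
        unfolding B_def
      proof (rule mult_left_mono[OF _ CK])
        have "harm N ^ l / N \<le> 1 / N * harm N ^ Suc l" using hl' by (simp add: divide_right_mono)
        also have "\<dots> \<le> (e + 1 / N) * harm N ^ Suc l" using e hl by (intro mult_right_mono) auto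
        finally show "harm N ^ l / N \<le> (e + 1 / N) * harm N ^ Suc l" .
      qed
      finally show ?thesis by (simp add: norm_mult norm_power \<eta>(2))
    qed
    moreover have "norm (\<eta> * (b a 1 - b inv_nat 1)) \<le> 2 * C * K1 * B"
    proof -
      have "norm (b a 1 - b inv_nat 1) \<le> 2 * C * K1 * e"
        using cb[OF M, of 1] N by (simp add: rel_close_def harm_def mult_ac)
      also have "\<dots> \<le> 2 * C * K1 * B"
        unfolding B_def
      proof (rule mult_left_mono[OF _ CK])
        have "e * 1 \<le> e * harm N ^ Suc l" using hl e by (rule mult_left_mono)
        also have "\<dots> \<le> (e + 1 / N) * harm N ^ Suc l" using e hl by (intro mult_right_mono) auto
        finally show "e \<le> (e + 1 / N) * harm N ^ Suc l" by simp
      qed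
      finally show ?thesis by (simp add: norm_mult \<eta>(2))
    qed
    moreover have "norm ((\<Sum>n\<in>{1..<N}. d a n) - c) \<le> K * B"
      unfolding B_def using K(2)[OF N e] cl[OF M] by blast
    ultimately have "norm (\<eta> - 1) * norm (csum a N (x # u) - c') \<le> (4 * C * K1 + K) * B"
      by (simp add: algebra_simps)
    then have "norm (csum a N (x # u) - c') \<le> K' * B"
      using \<eta>(1) by (simp add: K'_def field_simps)
    then show "norm (csum a N (x # u) - c') \<le> K' * ((e + 1 / N) * harm N ^ Suc (length u))"
      by (simp add: B_def l_def)
  qed
qed

section \<open>Asymptotics for families of coefficients\<close>

definition log_pow :: "nat \<Rightarrow> nat \<Rightarrow> complex" where
  "log_pow J m = of_real (ln (real m) ^ J)"

definition log_err :: "nat \<Rightarrow> nat \<Rightarrow> complex" where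
  "log_err J m = of_real (ln (real m) ^ J / real m)"

lemma eventually_ln_ge_1: "\<forall>\<^sub>F m :: nat in sequentially. ln (real m) \<ge> 1"
  by real_asymp

lemma log_err_mono:
  assumes "f \<in> O(log_err J)" "J \<le> J'"
  shows "f \<in> O(log_err J')"
proof (rule landau_o.big_trans[OF assms(1)])
  have "\<forall>\<^sub>F m in sequentially. norm (log_err J m) \<le> 1 * norm (log_err J' m)"
    using eventually_ln_ge_1
  proof eventually_elim
    case (elim m)
    then have "ln (real m) ^ J / m \<le> ln (real m) ^ J' / m"
      by (intro divide_right_mono power_increasing assms) auto
    then show ?case using elim by (simp add: log_err_def norm_divide norm_power)
  qed
  then show "log_err J \<in> O(log_err J')" by (rule bigoI)
qed

lemma log_pow_mono:
  assumes "f \<in> O(log_pow J)" "J \<le> J'"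
  shows "f \<in> O(log_pow J')"
proof (rule landau_o.big_trans[OF assms(1)])
  have "\<forall>\<^sub>F m in sequentially. norm (log_pow J m) \<le> 1 * norm (log_pow J' m)"
    using eventually_ln_ge_1
  proof eventually_elim
    case (elim m)
    then show ?case using power_increasing[OF assms(2) elim] by (simp add: log_pow_def norm_power)
  qed
  then show "log_pow J \<in> O(log_pow J')" by (rule bigoI)
qed

lemma log_err_imp_log_pow:
  assumes "f \<in> O(log_err J)"
  shows "f \<in> O(log_pow J)"
proof (rule landau_o.big_trans[OF assms(1)])
  have "norm (log_err J m) \<le> 1 * norm (log_pow J m)" for m
    by (cases "m = 0") (auto simp: log_err_def log_pow_def norm_divide norm_power divide_le_eq mult_le_cancel_left1)
  then show "log_err J \<in> O(log_pow J)" by (intro bigoI always_eventually allI)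
qed

lemma log_pow_mult_log_err:
  "f \<in> O(log_pow i) \<Longrightarrow> g \<in> O(log_err j) \<Longrightarrow> (\<lambda>m. f m * g m) \<in> O(log_err (i + j))"
  using landau_o.big.mult[of f _ "log_pow i" g "log_err j"]
  by (simp add: log_pow_def[abs_def] log_err_def[abs_def] power_add)

lemma log_pow_mult:
  "f \<in> O(log_pow i) \<Longrightarrow> g \<in> O(log_pow j) \<Longrightarrow> (\<lambda>m. f m * g m) \<in> O(log_pow (i + j))"
  using landau_o.big.mult[of f _ "log_pow i" g "log_pow j"]
  by (simp add: log_pow_def[abs_def] power_add)

text \<open>The coefficients may change with m, and the cut \<open>M m\<close> is comparable to m,
  so both errors \<open>e\<close> and 1 / N are O(1 / m). The function \<open>T\<close> is the
  asymptotic value of the sum of the letter (1, 1), the one generator whose behavior depends on the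
  family.\<close>

definition family :: "real \<Rightarrow> (nat \<Rightarrow> nat \<Rightarrow> complex) \<Rightarrow> (nat \<Rightarrow> nat) \<Rightarrow> (nat \<Rightarrow> complex) \<Rightarrow> bool" where
  "family C a M T \<longleftrightarrow>
     (\<exists>D. \<forall>\<^sub>F m in sequentially. perturbed_inv (D / real m) C (M m) (a m) \<and> M m \<le> m \<and> real m \<le> C * real (M m)) \<and>
     (\<lambda>m. csum (a m) (M m) [(1, 1)] - T m) \<in> O(log_err 1)"

lemma harm_le_ln:
  assumes "ln (real m) \<ge> 1"
  shows "harm m \<le> 2 * ln (real m)"
proof -
  have "m \<ge> 1" using assms by (cases m) auto
  then show ?thesis
    using assms euler_mascheroni_sequence_decreasing[of 1 m] by (simp add: harm_def)
qed

lemma csum_family_log_pow: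
  assumes "family C a M T" "index_word w" "1 \<le> C"
  shows "(\<lambda>m. csum (a m) (M m) w) \<in> O(log_pow (length w))"
proof -
  obtain K where K: "K \<ge> 0" "\<And>e a N. perturbed_inv e C N a \<Longrightarrow>
    rel_close (e * N) (K * harm N ^ length w) (csum a N w) (csum inv_nat N w)"
    using csum_close[OF assms(2,3)] by blast
  obtain D where D:
    "\<forall>\<^sub>F m in sequentially. perturbed_inv (D / real m) C (M m) (a m) \<and> M m \<le> m \<and> real m \<le> C * real (M m)"
    using assms(1) by (auto simp: family_def)
  from D eventually_ln_ge_1
  have "\<forall>\<^sub>F m in sequentially. norm (csum (a m) (M m) w) \<le> (K * 2 ^ length w) * norm (log_pow (length w) m)"
  proof eventually_elim
    case (elim m)
    have "norm (csum (a m) (M m) w) \<le> K * harm (M m) ^ length w"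
      using K(2) elim(1) unfolding rel_close_def by blast
    also have "\<dots> \<le> K * (2 * ln (real m)) ^ length w"
      using harm_le_ln[OF elim(2)] harm_mono[of "M m" m, where 'a = real] elim(1) K(1)
      by (intro mult_left_mono power_mono) (auto simp: harm_nonneg)
    also have "\<dots> = (K * 2 ^ length w) * norm (log_pow (length w) m)"
      using elim(2) by (simp add: log_pow_def power_mult_distrib norm_power)
    finally show ?case .
  qed
  then show ?thesis by (rule bigoI)
qed

text \<open>The limit \<open>c\<close> precedes the quantifiers over the family: it depends on the
  word and on \<open>C\<close> only, so sums over 1 / n and over 1 / [n] share it.\<close>

lemma csum_family_admissible:
  assumes "index_word (x # u)" "x \<noteq> (1, 1)" "1 \<le> C"
  shows "\<exists>c. \<forall>a M T. family C a M T \<longrightarrow>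
    (\<lambda>m. csum (a m) (M m) (x # u) - c) \<in> O(log_err (Suc (length u)))"
proof -
  let ?l = "Suc (length u)"
  obtain c K where K: "K \<ge> 0" "\<And>e a N. N \<ge> 1 \<Longrightarrow> perturbed_inv e C N a \<Longrightarrow>
    norm (csum a N (x # u) - c) \<le> K * ((e + 1 / N) * harm N ^ ?l)"
    using csum_admissible[OF assms] by blast
  have "(\<lambda>m. csum (a m) (M m) (x # u) - c) \<in> O(log_err ?l)" if fam: "family C a M T" for a M T
  proof -
    obtain D where D:
      "\<forall>\<^sub>F m in sequentially. perturbed_inv (D / real m) C (M m) (a m) \<and> M m \<le> m \<and> real m \<le> C * real (M m)"
      using fam by (auto simp: family_def)
    from D eventually_ln_ge_1 eventually_gt_at_top[of 0]
    have "\<forall>\<^sub>F m in sequentially. norm (csum (a m) (M m) (x # u) - c) \<le>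
      (K * (D + C) * 2 ^ ?l) * norm (log_err ?l m)"
    proof eventually_elim
      case (elim m)
      then have M: "perturbed_inv (D / real m) C (M m) (a m)" "M m \<le> m" "real m \<le> C * real (M m)" "m > 0" by auto
      then have "M m \<noteq> 0" by (intro notI) auto
      then have M0: "M m \<ge> 1" by simp
      have "1 / M m \<le> C / m" using M M0 by (simp add: field_simps)
      then have "D / m + 1 / M m \<le> (D + C) / m" by (simp add: add_divide_distrib)
      moreover have "harm (M m) \<le> 2 * ln (real m)"
        using harm_le_ln[OF elim(2)] harm_mono[of "M m" m, where 'a = real] M by linarith
      moreover have "0 \<le> D / m" using M by (simp add: perturbed_inv_def)
      ultimately have "(D / m + 1 / M m) * harm (M m) ^ ?l \<le> (D + C) / m * (2 * ln (real m)) ^ ?l"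
        by (intro mult_mono power_mono) (auto simp: harm_nonneg intro: order_trans[of 0 "D / m + 1 / M m"])
      then have "K * ((D / m + 1 / M m) * harm (M m) ^ ?l) \<le> K * ((D + C) / m * (2 * ln (real m)) ^ ?l)"
        using K(1) by (rule mult_left_mono)
      with K(2)[OF M0 M(1)]
      have "norm (csum (a m) (M m) (x # u) - c) \<le> K * ((D + C) / m * (2 * ln (real m)) ^ ?l)" by linarith
      also have "\<dots> = (K * (D + C) * 2 ^ ?l) * norm (log_err ?l m)"
        using elim(2) by (simp add: log_err_def power_mult_distrib norm_divide norm_mult norm_power)
      finally show ?case .
    qed
    then show ?thesis by (rule bigoI)
  qed
  then show ?thesis by blast
qed

lemma poly_sum_list: "poly (sum_list ps) x = sum_list (map (\<lambda>p. poly p x) ps)"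
  by (induction ps) auto

lemma sum_list_in_bigo:
  assumes "\<And>x. x \<in> set xs \<Longrightarrow> f x \<in> O[F](g)"
  shows "(\<lambda>m. \<Sum>x\<leftarrow>xs. f x m) \<in> O[F](g)"
  using assms by (induction xs) (auto intro: sum_in_bigo)

text \<open>The product of (1, 1) with the rest of the word contains the word itself with nonzero
  multiplicity, and all its other terms have fewer leading letters (1, 1). Solving for the word
  works identically in every family, whence one \<open>P\<close> for all. The exponent is the weight
  rather than the length because all words of the product have the same weight while merging
  shortens them.\<close>

theorem csum_family_asymptotics:
  assumes "1 \<le> C" "index_word w"
  shows "\<exists>P. \<forall>a M T. family C a M T \<longrightarrow>
    (\<lambda>m. csum (a m) (M m) w - poly P (T m)) \<in> O(log_err (weight w))"
  using assms(2)
proof (induction "lead w" arbitrary: w rule: less_induct)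
  case (less w)
  show ?case
  proof (cases w)
    case Nil
    then show ?thesis by (intro exI[of _ 1]) simp
  next
    case (Cons x u)
    show ?thesis
    proof (cases "x = (1, 1)")
      case False
      obtain c where c: "\<And>a M T. family C a M T \<Longrightarrow>
        (\<lambda>m. csum (a m) (M m) (x # u) - c) \<in> O(log_err (Suc (length u)))"
        using csum_family_admissible[of x u C] less.prems Cons False assms(1) by blast
      have "(\<lambda>m. csum (a m) (M m) w - poly [:c:] (T m)) \<in> O(log_err (weight w))"
        if "family C a M T" for a M T
        using log_err_mono[OF c[OF that]] length_le_weight[OF less.prems] Cons by simp
      then show ?thesis by blast
    next
      case True
      have u: "index_word u" "lead u < lead w" "weight w = Suc (weight u)"
        using less.prems Cons True by auto
      obtain Q where Q: "\<And>a M T. family C a M T \<Longrightarrow>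
          (\<lambda>m. csum (a m) (M m) u - poly Q (T m)) \<in> O(log_err (weight u))"
        using less.hyps[OF u(2,1)] by blast
      obtain R where R: "\<And>f :: _ \<Rightarrow> complex. sum_list (map f (stuffle1 u)) =
          of_nat (Suc (lead u)) * f ((1, 1) # u) + sum_list (map f R)"
        "\<And>w'. w' \<in> set R \<Longrightarrow> lead w' \<le> lead u \<and> index_word w' \<and> weight w' = Suc (weight u)"
        using stuffle1_lead[OF u(1)] by blast
      have "\<forall>w'\<in>set R. \<exists>P. \<forall>a M T. family C a M T \<longrightarrow>
        (\<lambda>m. csum (a m) (M m) w' - poly P (T m)) \<in> O(log_err (weight w))"
      proof
        fix w' assume "w' \<in> set R"
        with R(2)[OF this] u less.hyps[of w']
        show "\<exists>P. \<forall>a M T. family C a M T \<longrightarrow>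
          (\<lambda>m. csum (a m) (M m) w' - poly P (T m)) \<in> O(log_err (weight w))" by auto
      qed
      then obtain p where p: "\<And>w' a M T. w' \<in> set R \<Longrightarrow> family C a M T \<Longrightarrow>
        (\<lambda>m. csum (a m) (M m) w' - poly (p w') (T m)) \<in> O(log_err (weight w))"
        unfolding bchoice_iff by blast
      define s :: complex where "s = of_nat (Suc (lead u))"
      have s: "s \<noteq> 0" unfolding s_def by (simp del: of_nat_Suc)
      \<comment> \<open>This is the harmonic product solved for the word, with the sum of (1, 1)
        replaced by the variable.\<close>
      define P where "P = smult (1 / s) ([:0, 1:] * Q - sum_list (map p R))"
      have "(\<lambda>m. csum (a m) (M m) w - poly P (T m)) \<in> O(log_err (weight w))"
        if fam: "family C a M T" for a M T
      proof -
        let ?X = "\<lambda>m. csum (a m) (M m) [(1, 1)]"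
        let ?U = "\<lambda>m. csum (a m) (M m) u"
        have XT: "(\<lambda>m. ?X m - T m) \<in> O(log_err 1)" using fam by (simp add: family_def)
        have X: "?X \<in> O(log_pow 1)"
          using csum_family_log_pow[OF fam, of "[(1, 1)]"] assms(1) by simp
        have T: "T \<in> O(log_pow 1)"
          using sum_in_bigo(2)[OF X log_err_imp_log_pow[OF XT]] by simp
        \<comment> \<open>The error of the product is split as X U - T Q(T) = U (X - T) + T (U -
          Q(T)). Either summand pairs a power of the logarithm with an error of order log^j m / m,
          and the exponents add up to at most the weight of \<open>w\<close>.\<close>
        have "(\<lambda>m. ?U m * (?X m - T m)) \<in> O(log_err (weight w))"
          using log_err_mono[OF log_pow_mult_log_err[OF csum_family_log_pow[OF fam u(1) assms(1)] XT]]
            length_le_weight[OF u(1)] u(3) by simp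
        moreover have "(\<lambda>m. T m * (?U m - poly Q (T m))) \<in> O(log_err (weight w))"
          using log_pow_mult_log_err[OF T Q[OF fam]] u(3) by simp
        moreover have "(\<lambda>m. \<Sum>w'\<leftarrow>R. csum (a m) (M m) w' - poly (p w') (T m)) \<in> O(log_err (weight w))"
          by (intro sum_list_in_bigo p fam)
        ultimately have "(\<lambda>m. ?U m * (?X m - T m) + T m * (?U m - poly Q (T m)) -
            (\<Sum>w'\<leftarrow>R. csum (a m) (M m) w' - poly (p w') (T m))) \<in> O(log_err (weight w))"
          by (intro sum_in_bigo)
        moreover have "?U m * (?X m - T m) + T m * (?U m - poly Q (T m)) -
            (\<Sum>w'\<leftarrow>R. csum (a m) (M m) w' - poly (p w') (T m)) =
            s * (csum (a m) (M m) w - poly P (T m))" for m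
        proof -
          have "?X m * ?U m = s * csum (a m) (M m) w + (\<Sum>w'\<leftarrow>R. csum (a m) (M m) w')"
            unfolding csum_mult_stuffle1 R(1) using Cons True by (simp add: s_def)
          moreover have "s * poly P (T m) = T m * poly Q (T m) - (\<Sum>w'\<leftarrow>R. poly (p w') (T m))"
            using s by (simp add: P_def poly_sum_list comp_def)
          ultimately show ?thesis by (simp add: sum_list_subtractf algebra_simps)
        qed
        ultimately show ?thesis using s by simp
      qed
      then show ?thesis by blast
    qed
  qed
qed

section \<open>The cotangent sum\<close>

text \<open>This is the cotangent without its pole at 0. The pole produces the harmonic sum, while
  the regular part produces a Riemann sum over the interval from 0 to \<pi> / 2.\<close>

definition cot_reg :: "real \<Rightarrow> real" where "cot_reg y = cot y - 1 / y"

text \<open>This is the antiderivative of \<open>cot_reg\<close> that tends to 0 at 0; its value at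
  \<pi> / 2 is ln (2 / \<pi>).\<close>

definition ln_sinc :: "real \<Rightarrow> real" where "ln_sinc y = ln (sin y / y)"

lemma DERIV_ln_sinc:
  assumes "0 < y" "y < pi"
  shows "(ln_sinc has_real_derivative cot_reg y) (at y)"
proof -
  have s: "sin y > 0" using assms by (rule sin_gt_zero)
  have "((\<lambda>y. ln (sin y / y)) has_real_derivative cot_reg y) (at y)"
    by (rule derivative_eq_intros refl | use assms s in \<open>force simp: cot_reg_def cot_def field_simps\<close>)+
  then show ?thesis by (simp add: ln_sinc_def[abs_def])
qed

text \<open>The derivative is 1 / z^2 - 1 / sin^2 z, which is nonpositive because 0 < sin z \<le>
  z.\<close>

lemma cot_reg_antimono:
  assumes "0 < x" "x \<le> y" "y < pi"
  shows "cot_reg y \<le> cot_reg x"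
proof (rule DERIV_nonpos_imp_nonincreasing[OF assms(2)])
  fix z assume z: "x \<le> z" "z \<le> y"
  then have z': "0 < z" "z < pi" using assms by auto
  then have s: "sin z > 0" by (rule sin_gt_zero)
  have "(cot_reg has_real_derivative (- inverse ((sin z)\<^sup>2) + 1 / z\<^sup>2)) (at z)"
    unfolding cot_reg_def[abs_def]
    by (rule derivative_eq_intros DERIV_cot refl | use z' s in \<open>force simp: power2_eq_square field_simps\<close>)+
  moreover have "1 / z\<^sup>2 \<le> 1 / (sin z)\<^sup>2"
    using s z' sin_x_le_x[of z] by (intro divide_left_mono power_mono) auto
  ultimately show "\<exists>D. (cot_reg has_real_derivative D) (at z) \<and> D \<le> 0"
    by (intro exI[of _ "- inverse ((sin z)\<^sup>2) + 1 / z\<^sup>2"]) (simp add: inverse_eq_divide)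
qed

lemma ln_sinc_diff_bounds:
  assumes "0 < x" "x \<le> y" "y < pi"
  shows "(y - x) * cot_reg y \<le> ln_sinc y - ln_sinc x"
    and "ln_sinc y - ln_sinc x \<le> (y - x) * cot_reg x"
proof -
  have "(y - x) * cot_reg y \<le> ln_sinc y - ln_sinc x \<and> ln_sinc y - ln_sinc x \<le> (y - x) * cot_reg x"
  proof (cases "x = y")
    case False
    with assms have "x < y" by simp
    then obtain z where z: "x < z" "z < y" "ln_sinc y - ln_sinc x = (y - x) * cot_reg z"
      using MVT2[of x y ln_sinc cot_reg] DERIV_ln_sinc assms by (metis order_less_le_trans order_le_less_trans)
    then show ?thesis
      using assms cot_reg_antimono[of x z] cot_reg_antimono[of z y] by (auto intro!: mult_left_mono)
  qed simp
  then show "(y - x) * cot_reg y \<le> ln_sinc y - ln_sinc x" "ln_sinc y - ln_sinc x \<le> (y - x) * cot_reg x"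
    by auto
qed

lemma sum_cot_reg_lower:
  fixes M :: nat and d :: real
  assumes "0 < d" "1 \<le> M" "M * d < pi"
  shows "ln_sinc (M * d) - ln_sinc d \<le> (\<Sum>n\<in>{1..<M}. d * cot_reg (n * d))"
  using assms(2,3)
proof (induction M rule: dec_induct)
  case base
  then show ?case by simp
next
  case (step n)
  have "n * d < pi" using step.prems assms(1) by (simp add: algebra_simps)
  moreover have "ln_sinc (Suc n * d) - ln_sinc (n * d) \<le> (Suc n * d - n * d) * cot_reg (n * d)"
    using step assms(1) by (intro ln_sinc_diff_bounds) auto
  ultimately show ?case using step by (simp add: algebra_simps)
qed

text \<open>The term n = 1 stands apart because the interval to its left would begin at 0, outside
  the range of \<open>ln_sinc_diff_bounds\<close>. The integral ends at the last node M - 1, whereas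
  the lower bound integrates up to M.\<close>

lemma sum_cot_reg_upper:
  fixes M :: nat and d :: real
  assumes "0 < d" "2 \<le> M" "real (M - 1) * d < pi"
  shows "(\<Sum>n\<in>{1..<M}. d * cot_reg (n * d)) \<le> d * cot_reg d + ln_sinc (real (M - 1) * d) - ln_sinc d"
  using assms(2,3)
proof (induction M rule: dec_induct)
  case base
  then show ?case by (simp add: numeral_2_eq_2)
next
  case (step n)
  have n: "Suc (n - 1) = n" using step by simp
  have "n * d < pi" "real (n - 1) * d \<le> n * d" using step.prems assms(1) by (auto simp: algebra_simps)
  moreover have "(n * d - real (n - 1) * d) * cot_reg (n * d) \<le> ln_sinc (n * d) - ln_sinc (real (n - 1) * d)"
    using step calculation assms(1) by (intro ln_sinc_diff_bounds) auto
  moreover have "n * d - real (n - 1) * d = d" using step by (simp add: of_nat_diff algebra_simps)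
  ultimately show ?case using step by (simp add: algebra_simps)
qed

text \<open>The derivative \<open>cot_reg\<close> is monotone, so on this interval it is bounded by
  its values at the two ends, and \<open>ln_sinc\<close> is Lipschitz there.\<close>

lemma ln_sinc_near_pi_half:
  "\<exists>B. \<forall>y. pi / 4 \<le> y \<longrightarrow> y \<le> 3 * pi / 4 \<longrightarrow> \<bar>ln_sinc y - ln (2 / pi)\<bar> \<le> B * \<bar>y - pi / 2\<bar>"
proof (intro exI allI impI)
  let ?B = "\<bar>cot_reg (pi / 4)\<bar> + \<bar>cot_reg (3 * pi / 4)\<bar>"
  fix y assume y: "pi / 4 \<le> y" "y \<le> 3 * pi / 4"
  have p: "0 < pi / 4" "3 * pi / 4 < pi" "pi / 4 \<le> pi / 2" "pi / 2 \<le> 3 * pi / 4" using pi_gt_zero by simp_all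
  have B: "\<bar>cot_reg z\<bar> \<le> ?B" if "pi / 4 \<le> z" "z \<le> 3 * pi / 4" for z
    using cot_reg_antimono[of "pi / 4" z] cot_reg_antimono[of z "3 * pi / 4"] that p by linarith
  have D: "\<bar>ln_sinc v - ln_sinc u\<bar> \<le> ?B * (v - u)" if "pi / 4 \<le> u" "u \<le> v" "v \<le> 3 * pi / 4" for u v
  proof -
    have "\<bar>(v - u) * cot_reg u\<bar> \<le> (v - u) * ?B" "\<bar>(v - u) * cot_reg v\<bar> \<le> (v - u) * ?B"
      using B[of u] B[of v] that by (auto simp: abs_mult intro!: mult_left_mono)
    moreover have "(v - u) * cot_reg v \<le> ln_sinc v - ln_sinc u" "ln_sinc v - ln_sinc u \<le> (v - u) * cot_reg u"
      using that p by (intro ln_sinc_diff_bounds; linarith)+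
    ultimately show ?thesis by (simp add: mult.commute)
  qed
  have "ln_sinc (pi / 2) = ln (2 / pi)" by (simp add: ln_sinc_def)
  then show "\<bar>ln_sinc y - ln (2 / pi)\<bar> \<le> ?B * \<bar>y - pi / 2\<bar>"
    using D[of y "pi / 2"] D[of "pi / 2" y] y p by (cases "y \<le> pi / 2") (auto simp: abs_minus_commute)
qed

text \<open>For a monotone integrand the Riemann sum with step \<pi> / m lies between two integrals
  that differ by O(1 / m). Both upper ends are within \<pi> / m of \<pi> / 2, and the integral up to
  there is ln (2 / \<pi>).\<close>

lemma sum_cot_reg_asymp:
  fixes M :: "nat \<Rightarrow> nat"
  assumes M: "\<And>m. m / 2 \<le> M m" "\<And>m. M m \<le> m / 2 + 1"
  shows "(\<lambda>m. (\<Sum>n\<in>{1..<M m}. pi / m * cot_reg (n * (pi / m))) - ln (2 / pi)) \<in> O(\<lambda>m. 1 / real m)"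
proof -
  obtain B where B: "\<And>y. pi / 4 \<le> y \<Longrightarrow> y \<le> 3 * pi / 4 \<Longrightarrow> \<bar>ln_sinc y - ln (2 / pi)\<bar> \<le> B * \<bar>y - pi / 2\<bar>"
    using ln_sinc_near_pi_half by blast
  have near: "\<bar>ln_sinc (k * (pi / m)) - ln (2 / pi)\<bar> \<le> \<bar>B\<bar> * pi * (1 / m)"
    if "m \<ge> 4" "m / 2 - 1 \<le> k" "k \<le> m / 2 + 1" for k m :: nat
  proof -
    have "k * (pi / m) - pi / 2 = pi * (1 / m) * (k - m / 2)" using that(1) by (simp add: field_simps)
    then have a: "\<bar>k * (pi / m) - pi / 2\<bar> = pi * (1 / m) * \<bar>k - m / 2\<bar>" by (simp add: abs_mult)
    also have "\<dots> \<le> pi * (1 / m) * 1" using that by (intro mult_left_mono) auto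
    finally have b: "\<bar>k * (pi / m) - pi / 2\<bar> \<le> pi * (1 / m)" by simp
    also have "\<dots> \<le> pi * (1 / 4)" using that(1) by (intro mult_left_mono) (auto simp: field_simps)
    finally have "pi / 4 \<le> k * (pi / m)" "k * (pi / m) \<le> 3 * pi / 4" unfolding abs_le_iff by linarith+
    then have "\<bar>ln_sinc (k * (pi / m)) - ln (2 / pi)\<bar> \<le> B * \<bar>k * (pi / m) - pi / 2\<bar>"
      by (rule B)
    also have "\<dots> \<le> \<bar>B\<bar> * (pi * (1 / m))" using b by (intro mult_mono) auto
    finally show ?thesis by simp
  qed
  have "(\<lambda>m::nat. ln_sinc (pi / m)) \<in> O(\<lambda>m. 1 / real m)"
    unfolding ln_sinc_def by real_asymp
  moreover have "(\<lambda>m::nat. pi / m * cot_reg (pi / m)) \<in> O(\<lambda>m. 1 / real m)"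
    unfolding cot_reg_def cot_def by real_asymp
  moreover have "(\<lambda>m::nat. \<bar>B\<bar> * pi * (1 / m)) \<in> O(\<lambda>m. 1 / real m)"
    by (intro bigoI[where c = "\<bar>B\<bar> * pi"] always_eventually allI) (simp add: abs_mult)
  ultimately have "(\<lambda>m::nat. \<bar>ln_sinc (pi / m)\<bar> + \<bar>pi / m * cot_reg (pi / m)\<bar> + \<bar>B\<bar> * pi * (1 / m)) \<in> O(\<lambda>m. 1 / real m)"
    by (intro sum_in_bigo) (simp_all only: landau_o.big.abs_in_iff)
  moreover have "(\<lambda>m. (\<Sum>n\<in>{1..<M m}. pi / m * cot_reg (n * (pi / m))) - ln (2 / pi)) \<in>
    O(\<lambda>m::nat. \<bar>ln_sinc (pi / m)\<bar> + \<bar>pi / m * cot_reg (pi / m)\<bar> + \<bar>B\<bar> * pi * (1 / m))"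
  proof (rule bigoI[where c = 1], rule eventually_sequentiallyI[of 4])
    fix m :: nat assume m: "m \<ge> 4"
    define d where "d = pi / m"
    have d: "d > 0" using m by (simp add: d_def)
    have M2: "real (M m) \<ge> 2" using M(1)[of m] m by simp
    then have M2': "M m \<ge> 2" by linarith
    have "M m * d \<le> (m / 2 + 1) * d" using M(2)[of m] d by (intro mult_right_mono) auto
    also have "\<dots> = pi / 2 + pi / m" using m by (simp add: d_def field_simps)
    also have "\<dots> < pi" using m pi_gt_zero by (simp add: field_simps)
    finally have lt: "M m * d < pi" .
    have lt2: "real (M m - 1) * d < pi"
      using lt d M2' by (auto simp: of_nat_diff algebra_simps)
    have "ln_sinc (M m * d) - ln_sinc d \<le> (\<Sum>n\<in>{1..<M m}. d * cot_reg (n * d))"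
      using sum_cot_reg_lower[of d "M m"] d M2' lt by simp
    moreover have "(\<Sum>n\<in>{1..<M m}. d * cot_reg (n * d)) \<le> d * cot_reg d + ln_sinc (real (M m - 1) * d) - ln_sinc d"
      using sum_cot_reg_upper[of d "M m"] d M2' lt2 by simp
    moreover have "\<bar>ln_sinc (M m * d) - ln (2 / pi)\<bar> \<le> \<bar>B\<bar> * pi * (1 / m)"
      unfolding d_def using M(1)[of m] M(2)[of m] m by (intro near) auto
    moreover have "\<bar>ln_sinc (real (M m - 1) * d) - ln (2 / pi)\<bar> \<le> \<bar>B\<bar> * pi * (1 / m)"
      unfolding d_def using M(1)[of m] M(2)[of m] m M2' by (intro near) (auto simp: of_nat_diff)
    ultimately have "\<bar>(\<Sum>n\<in>{1..<M m}. d * cot_reg (n * d)) - ln (2 / pi)\<bar> \<le>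
      \<bar>ln_sinc d\<bar> + \<bar>d * cot_reg d\<bar> + \<bar>B\<bar> * pi * (1 / m)" by linarith
    then show "norm ((\<Sum>n\<in>{1..<M m}. pi / m * cot_reg (n * (pi / m))) - ln (2 / pi)) \<le>
      1 * norm (\<bar>ln_sinc (pi / m)\<bar> + \<bar>pi / m * cot_reg (pi / m)\<bar> + \<bar>B\<bar> * pi * (1 / m))"
      by (simp add: d_def)
  qed
  ultimately show ?thesis by (rule landau_o.big_trans[rotated])
qed

lemma harmonic_sum_asymp:
  "m \<ge> 1 \<Longrightarrow> \<bar>(\<Sum>n\<in>{1..<m}. 1 / real n) - (ln m + euler_mascheroni)\<bar> \<le> 3 / m"
proof -
  assume m: "m \<ge> 1"
  have "harm m = (\<Sum>n\<in>{1..<Suc m}. 1 / real n)"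
    unfolding harm_def by (intro sum.cong) (auto simp: divide_inverse)
  then have h: "harm m = (\<Sum>n\<in>{1..<m}. 1 / real n) + 1 / m" using m by simp
  have "1 + 1 / m = real (Suc m) / real m" using m by (simp add: field_simps)
  moreover have "ln (real (Suc m) / real m) = ln (real (Suc m)) - ln m" using m by (intro ln_divide_pos) auto
  ultimately have "ln (real (Suc m)) - ln m = ln (1 + 1 / m)" by metis
  then have "0 \<le> ln (real (Suc m)) - ln m" "ln (real (Suc m)) - ln m \<le> 1 / m"
    using ln_add_one_self_le_self[of "1 / m"] by auto
  moreover have "inverse (real (2 * (m + 1))) \<ge> 0" "inverse (real (2 * m)) \<le> 1 / m"
    using m by (auto simp: field_simps)
  moreover have "0 \<le> 1 / real m" "3 / real m = 3 * (1 / m)" by simp_all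
  ultimately show ?thesis using euler_mascheroni_bounds[OF m] h
    unfolding atLeastAtMost_iff abs_le_iff by linarith
qed

text \<open>The pole of the cotangent contributes ln (m / 2) + \<gamma> and the regular part ln (2 /
  \<pi>). Their sum is ln (m / \<pi>) + \<gamma>, which is where the \<pi> under the logarithm comes
  from.\<close>

lemma sum_cot_asymp:
  fixes M :: "nat \<Rightarrow> nat"
  assumes M: "\<And>m. m / 2 \<le> M m" "\<And>m. M m \<le> m / 2 + 1"
  shows "(\<lambda>m. (\<Sum>n\<in>{1..<M m}. pi / m * cot (n * (pi / m))) - (ln (m / pi) + euler_mascheroni)) \<in> O(\<lambda>m. 1 / real m)"
proof -
  have "(\<lambda>m. (\<Sum>n\<in>{1..<M m}. 1 / real n) - (ln (m / 2) + euler_mascheroni)) \<in> O(\<lambda>m. 1 / real m)"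
  \<comment> \<open>The 8 is 2 + 6: replacing ln (M m) by ln (m / 2) costs 2 / m, and 3 / M m \<le>
    6 / m.\<close>
  proof (rule bigoI[where c = 8], rule eventually_sequentiallyI[of 1])
    fix m :: nat assume m: "m \<ge> 1"
    have M0: "M m > 0" using M(1)[of m] m by (cases "M m") auto
    have "ln (M m) - ln (m / 2) = ln (M m / (m / 2))"
      using m M0 by (intro ln_divide_pos[symmetric]) auto
    moreover have "1 \<le> M m / (m / 2)" "M m / (m / 2) \<le> 1 + 2 / m"
      using M(1)[of m] M(2)[of m] m by (auto simp: field_simps)
    moreover have "ln (1 + 2 / m) \<le> 2 / real m" by (rule ln_add_one_self_le_self) simp
    moreover have "ln (M m / (m / 2)) \<le> ln (1 + 2 / m)" "0 \<le> ln (M m / (m / 2))"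
      using calculation m by (intro ln_mono ln_ge_zero; linarith)+
    ultimately have "0 \<le> ln (M m) - ln (m / 2)" "ln (M m) - ln (m / 2) \<le> 2 / m"
      by linarith+
    moreover have "3 / M m \<le> 6 / m" using M(1)[of m] m M0 by (simp add: field_simps)
    moreover have "8 * (1 / real m) = 2 / m + 6 / m" by simp
    ultimately have "\<bar>(\<Sum>n\<in>{1..<M m}. 1 / real n) - (ln (m / 2) + euler_mascheroni)\<bar> \<le> 8 * (1 / m)"
      using harmonic_sum_asymp[of "M m"] M0 unfolding abs_le_iff by linarith
    then show "norm ((\<Sum>n\<in>{1..<M m}. 1 / real n) - (ln (m / 2) + euler_mascheroni)) \<le> 8 * norm (1 / real m)"
      by simp
  qed
  from sum_in_bigo(1)[OF this sum_cot_reg_asymp[OF M]]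
  have "(\<lambda>m. (\<Sum>n\<in>{1..<M m}. 1 / real n) - (ln (m / 2) + euler_mascheroni) +
     ((\<Sum>n\<in>{1..<M m}. pi / m * cot_reg (n * (pi / m))) - ln (2 / pi))) \<in> O(\<lambda>m. 1 / real m)" .
  moreover have "\<forall>\<^sub>F m in sequentially. (\<Sum>n\<in>{1..<M m}. 1 / real n) - (ln (m / 2) + euler_mascheroni) +
     ((\<Sum>n\<in>{1..<M m}. pi / m * cot_reg (n * (pi / m))) - ln (2 / pi)) =
     (\<Sum>n\<in>{1..<M m}. pi / m * cot (n * (pi / m))) - (ln (m / pi) + euler_mascheroni)"
  proof (rule eventually_sequentiallyI[of 1])
    fix m :: nat assume m: "m \<ge> 1"
    have "(\<Sum>n\<in>{1..<M m}. pi / m * cot (n * (pi / m))) =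
      (\<Sum>n\<in>{1..<M m}. 1 / real n + pi / m * cot_reg (n * (pi / m)))"
      using m by (intro sum.cong) (auto simp: cot_reg_def field_simps)
    moreover have "ln (m / pi) = ln (m / 2) + ln (2 / pi)"
      using m by (simp add: ln_div)
    ultimately show "(\<Sum>n\<in>{1..<M m}. 1 / real n) - (ln (m / 2) + euler_mascheroni) +
     ((\<Sum>n\<in>{1..<M m}. pi / m * cot_reg (n * (pi / m))) - ln (2 / pi)) =
     (\<Sum>n\<in>{1..<M m}. pi / m * cot (n * (pi / m))) - (ln (m / pi) + euler_mascheroni)"
      by (simp add: sum.distrib)
  qed
  ultimately show ?thesis using landau_o.big.in_cong by fast
qed

section \<open>The coefficients of the q-analogue\<close>

lemma log_err_0: "log_err 0 = (\<lambda>m. of_real (1 / real m))"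
  by (simp add: log_err_def[abs_def])

lemma of_real_in_log_err_0:
  "(\<lambda>m. of_real (f m)) \<in> O(log_err 0) \<longleftrightarrow> f \<in> O(\<lambda>m. 1 / real m)"
  unfolding log_err_0 by (rule landau_o.big.of_real_iff)

lemma log_pow_0_const: "(\<lambda>_. c) \<in> O(log_pow 0)"
  by (simp add: log_pow_def[abs_def])

lemma log_err_0_imp: "f \<in> O(log_err 0) \<Longrightarrow> f \<in> O(log_err J)"
  by (rule log_err_mono) auto

lemma family_inv_nat:
  assumes "1 \<le> C"
  shows "family C (\<lambda>_. inv_nat) (\<lambda>m. m) (\<lambda>m. of_real (ln (real m)) + euler_mascheroni)"
  unfolding family_def
proof
  show "\<exists>D. \<forall>\<^sub>F m in sequentially. perturbed_inv (D / real m) C m inv_nat \<and> m \<le> m \<and> real m \<le> C * real m"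
    using assms perturbed_inv_inv_nat[OF assms] by (intro exI[of _ 0] always_eventually) (auto simp: mult_le_cancel_right1)
  have "(\<lambda>m. (\<Sum>n\<in>{1..<m}. 1 / real n) - (ln m + euler_mascheroni)) \<in> O(\<lambda>m. 1 / real m)"
    by (rule bigoI[where c = 3], rule eventually_sequentiallyI[of 1]) (use harmonic_sum_asymp in simp)
  then have "(\<lambda>m. of_real ((\<Sum>n\<in>{1..<m}. 1 / real n) - (ln m + euler_mascheroni))) \<in> O(log_err 0)"
    unfolding of_real_in_log_err_0 .
  moreover have "(\<lambda>m. csum inv_nat m [(1, 1)] - (of_real (ln (real m)) + euler_mascheroni)) =
     (\<lambda>m. of_real ((\<Sum>n\<in>{1..<m}. 1 / real n) - (ln m + euler_mascheroni)))"
    by (simp add: csum_Cons letter_def inv_nat_def)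
  ultimately show "(\<lambda>m. csum inv_nat m [(1, 1)] - (of_real (ln (real m)) + euler_mascheroni)) \<in> O(log_err 1)"
    using log_err_0_imp by metis
qed

lemma bigo_cnj: "(\<lambda>m. cnj (f m)) \<in> O(g) \<longleftrightarrow> f \<in> O(g)"
proof -
  have "norm (cnj (f m)) = norm (f m)" for m by simp
  then show ?thesis by (metis (no_types, lifting) landau_o.big.norm_iff ext)
qed

lemma rel_close_cnj: "rel_close d X (cnj x) (cnj y) \<longleftrightarrow> rel_close d X x y"
  by (simp add: rel_close_def flip: complex_cnj_diff)

lemma perturbed_inv_cnj:
  assumes "perturbed_inv e C N a"
  shows "perturbed_inv e C N (\<lambda>n. cnj (a n))"
proof -
  have c: "cnj (inv_nat n) = inv_nat n" for n by (simp add: inv_nat_def)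
  have "rel_close (e * n) (C / n) (cnj (a n)) (inv_nat n)" if "n \<in> {1..N}" for n
    using assms that rel_close_cnj[of "e * n" "C / n" "a n" "inv_nat n"] by (simp add: perturbed_inv_def c)
  moreover have "rel_close (e * n) (C / real n ^ 2) (cnj (a (Suc n)) - cnj (a n)) (inv_nat (Suc n) - inv_nat n)"
    if "n \<in> {1..<N}" for n
    using assms that rel_close_cnj[of "e * n" "C / real n ^ 2" "a (Suc n) - a n" "inv_nat (Suc n) - inv_nat n"]
    by (simp add: perturbed_inv_def c)
  ultimately show ?thesis using assms by (simp add: perturbed_inv_def)
qed

text \<open>Reflection produces conjugate coefficients, so the upper half needs its own family.
  Conjugating \<open>T\<close> is what gives the two factors of the final formula opposite imaginary
  shifts.\<close>

lemma family_cnj: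
  assumes "family C a M T"
  shows "family C (\<lambda>m n. cnj (a m n)) M (\<lambda>m. cnj (T m))"
proof -
  obtain D where D:
    "\<forall>\<^sub>F m in sequentially. perturbed_inv (D / real m) C (M m) (a m) \<and> M m \<le> m \<and> real m \<le> C * real (M m)"
    using assms by (auto simp: family_def)
  have "\<forall>\<^sub>F m in sequentially. perturbed_inv (D / real m) C (M m) (\<lambda>n. cnj (a m n)) \<and> M m \<le> m \<and> real m \<le> C * real (M m)"
    using D by eventually_elim (auto intro: perturbed_inv_cnj)
  moreover have "(\<lambda>m. cnj (csum (a m) (M m) [(1, 1)] - T m)) \<in> O(log_err 1)"
    unfolding bigo_cnj using assms by (simp add: family_def)
  ultimately show ?thesis by (auto simp: family_def csum_cnj)
qed

section \<open>Estimates for 1 - q^n and 1 / [n] at a primitive root of unity\<close>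

lemma norm_one_minus_cis: "norm (1 - cis t) = 2 * \<bar>sin (t / 2)\<bar>"
  using dist_exp_i_1[of t] by (simp add: cis_conv_exp norm_minus_commute)

lemma norm_one_minus_cis_le: "norm (1 - cis t) \<le> \<bar>t\<bar>"
  using abs_sin_x_le_abs_x[of "t / 2"] by (simp add: norm_one_minus_cis)

text \<open>The sine is concave and hence lies above its chord from 0 to 3 \<pi> / 4, whose right
  end has height sqrt 2 / 2. The range reaches beyond \<pi> / 2 because the cuts may lie slightly
  above m / 2.\<close>

lemma sin_ge_linear:
  assumes "0 \<le> x" "x \<le> 3 * pi / 4"
  shows "2 * x / (3 * pi) * sqrt 2 \<le> sin x"
proof -
  have cv: "concave_on {0..3 * pi / 4} sin"
  proof (rule f''_le0_imp_concave)
    show "DERIV sin x :> cos x" for x :: real by (rule DERIV_sin)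
    show "DERIV cos x :> - sin x" for x :: real by (rule DERIV_cos)
    show "- sin x \<le> 0" if "x \<in> {0..3 * pi / 4}" for x :: real
      using that sin_ge_zero[of x] pi_gt_zero by auto
  qed simp
  define t where "t = 4 * x / (3 * pi)"
  have t: "0 \<le> t" "t \<le> 1" "t * (3 * pi / 4) = x" using assms pi_gt_zero by (auto simp: t_def field_simps)
  have "sin (3 * pi / 4) = sqrt 2 / 2"
    using sin_pi_minus[of "pi / 4"] by (simp add: sin_45 field_simps)
  with concave_onD[OF cv t(1,2), of 0 "3 * pi / 4"] t(3)
  have "t * (sqrt 2 / 2) \<le> sin x" using pi_gt_zero by simp
  then show ?thesis by (simp add: t_def)
qed

lemma q_int_eq_sum: "q \<noteq> 1 \<Longrightarrow> q_int q n = (\<Sum>j<n. q ^ j)"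
  by (simp add: q_int_def geometric_sum) (metis minus_diff_eq minus_divide_divide)

text \<open>All estimates rest on 28 / 15 n / m \<le> |1 - q^n| \<le> 7 n / m, from 2 \<pi> \<le> 7,
  sqrt 2 \<ge> 7 / 5 and the chord bound for the sine. They give |1 / [n]| \<le> 5 / n, and the
  identity for n - [n] as the sum of the 1 - q^j gives the distance 35 / m from 1 / n. The constants
  100 and 25 are generous; 25 is the square of 5, as differences are products of two
  reciprocals.\<close>

lemma q_perturbed_inv:
  fixes m :: nat
  assumes m: "m \<ge> 4" and N: "N \<le> 3 * m / 4"
  defines "q \<equiv> cis (2 * pi / m)"
  shows "perturbed_inv (100 / m) 25 N (\<lambda>n. inverse (q_int q n))"
proof -
  define a where "a n = inverse (q_int q n)" for n
  have qn: "q ^ n = cis (2 * pi * n / m)" for n by (simp add: q_def Complex.DeMoivre mult_ac)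
  have up: "norm (1 - q ^ n) \<le> 7 * n / m" for n
  proof -
    have "norm (1 - q ^ n) \<le> 2 * pi * n / m"
      using norm_one_minus_cis_le[of "2 * pi * n / m"] by (simp add: qn)
    also have "\<dots> \<le> 7 * n / m"
    proof (rule divide_right_mono)
      have "2 * pi \<le> 7" using pi_approx by auto
      from mult_right_mono[OF this, of "real n"] show "2 * pi * real n \<le> 7 * n" by simp
    qed simp
    finally show ?thesis by simp
  qed
  have lo: "norm (1 - q ^ n) \<ge> 28 / 15 * n / m" if n: "n \<in> {1..N}" for n
  proof -
    have "2 * (pi * n / m) / (3 * pi) * sqrt 2 \<le> sin (pi * n / m)"
    proof (rule sin_ge_linear)
      have "real n \<le> 3 * m / 4" using n N by auto
      then have "pi * (real n / m) \<le> pi * (3 / 4)" using m by (intro mult_left_mono) (auto simp: field_simps)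
      then show "pi * n / m \<le> 3 * pi / 4" by simp
    qed simp
    moreover have "sqrt 2 \<ge> 7 / 5" by (rule real_le_rsqrt) (simp add: power2_eq_square)
    then have "2 * n / (3 * m) * (7 / 5) \<le> 2 * n / (3 * m) * sqrt 2" by (intro mult_left_mono) auto
    ultimately show ?thesis by (simp add: qn norm_one_minus_cis)
  qed
  have q1: "1 - q ^ n \<noteq> 0" if "n \<in> {1..N}" for n
  proof -
    have "0 < 28 / 15 * n / m" using that m by (intro divide_pos_pos) auto
    with lo[OF that] have "0 < norm (1 - q ^ n)" by linarith
    then show ?thesis by simp
  qed
  have an: "a n = (1 - q) / (1 - q ^ n)" for n by (simp add: a_def q_int_def)
  have A: "norm (a n) \<le> 5 / n" if n: "n \<in> {1..N}" for n
  proof -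
    have "norm (a n) = norm (1 - q) / norm (1 - q ^ n)" by (simp add: an norm_divide)
    also have "\<dots> \<le> (7 / m) / (28 / 15 * n / m)"
      using up[of 1] lo[OF n] n m by (intro frac_le) auto
    also have "\<dots> \<le> 5 / n" using n m by (simp add: field_simps)
    finally show ?thesis .
  qed
  have B: "norm (a n - inv_nat n) \<le> 35 / m" if n: "n \<in> {1..N}" for n
  proof -
    have "1 \<in> {1..N}" using n by auto
    from q1[OF this] have "q \<noteq> 1" by auto
    have q0: "q_int q n \<noteq> 0" using q1[OF n] \<open>q \<noteq> 1\<close> by (simp add: q_int_def)
    have "of_nat n - q_int q n = (\<Sum>j<n. 1 - q ^ j)"
      using \<open>q \<noteq> 1\<close> by (simp add: q_int_eq_sum sum_subtractf)
    also have "norm \<dots> \<le> (\<Sum>j<n. 7 * n / m)"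
    proof (rule sum_norm_le)
      fix j assume "j \<in> {..<n}"
      then have "7 * real j / m \<le> 7 * n / m" by (intro divide_right_mono) auto
      with up[of j] show "norm (1 - q ^ j) \<le> 7 * n / m" by linarith
    qed
    finally have "norm (of_nat n - q_int q n) \<le> n * (7 * n / m)" by simp
    moreover have "a n - inv_nat n = (of_nat n - q_int q n) * a n / of_nat n"
      using q0 n by (simp add: a_def inv_nat_def field_simps)
    ultimately have "norm (a n - inv_nat n) \<le> (n * (7 * n / m)) * (5 / n) / n"
      using A[OF n] by (simp only: norm_mult norm_divide norm_of_nat) (intro divide_right_mono mult_mono, auto)
    also have "\<dots> = 35 / m" using n by simp
    finally show ?thesis .
  qed
  have I: "norm (inv_nat n) = 1 / n" for n by (simp add: inv_nat_def norm_divide)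
  show ?thesis
    unfolding perturbed_inv_def a_def[symmetric]
  proof (intro conjI ballI)
    fix n assume n: "n \<in> {1..N}"
    have "35 / m \<le> (100 / m * n) * (25 / n)" using n by simp (intro divide_right_mono, auto)
    moreover have "5 / n \<le> 25 / real n" "1 / n \<le> 25 / real n" by (auto intro: divide_right_mono)
    ultimately show "rel_close (100 / m * n) (25 / n) (a n) (inv_nat n)"
      unfolding rel_close_def I using A[OF n] B[OF n] by linarith
  next
    fix n assume n: "n \<in> {1..<N}"
    have nN: "n \<in> {1..N}" "Suc n \<in> {1..N}" using n by auto
    have A': "norm (a (Suc n)) \<le> 5 / n"
    proof -
      have "5 / Suc n \<le> 5 / real n" using n by (intro divide_left_mono) auto
      with A[OF nN(2)] show ?thesis by linarith
    qed
    have I': "norm (inv_nat (Suc n)) \<le> 1 / n" unfolding I using n by (intro divide_left_mono) auto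
    have aa: "norm (a n * a (Suc n)) \<le> 25 / real n ^ 2"
      using mult_mono[OF A[OF nN(1)] A'] by (simp add: norm_mult power2_eq_square)
    \<comment> \<open>The difference of reciprocals of q-integers is exactly -q^n times the product
      of two of them. It has the form of the identity \<open>di\<close> for 1 / n, so the two can be
      compared factor by factor.\<close>
    have da: "a (Suc n) - a n = - (q ^ n * (a n * a (Suc n)))"
    proof -
      have "a (Suc n) - a n = (1 - q) * ((1 - q ^ n) - (1 - q ^ Suc n)) / ((1 - q ^ n) * (1 - q ^ Suc n))"
        unfolding an using q1[OF nN(1)] q1[OF nN(2)] by (simp add: divide_simps del: power_Suc) (simp add: algebra_simps)
      also have "(1 - q ^ n) - (1 - q ^ Suc n) = - (q ^ n * (1 - q))"
        by (simp add: algebra_simps)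
      also have "(1 - q) * - (q ^ n * (1 - q)) / ((1 - q ^ n) * (1 - q ^ Suc n)) = - (q ^ n * (a n * a (Suc n)))"
        unfolding an by (simp add: mult_ac del: power_Suc)
      finally show ?thesis .
    qed
    have di: "inv_nat (Suc n) - inv_nat n = - (inv_nat n * inv_nat (Suc n))"
      using n inv_nat_diff[of n] by (simp add: inv_nat_def)
    have "norm (a (Suc n) - a n) \<le> 25 / real n ^ 2"
      unfolding da using aa by (simp add: norm_mult qn)
    moreover have "norm (inv_nat (Suc n) - inv_nat n) \<le> 25 / real n ^ 2"
    proof -
      have "norm (inv_nat (Suc n) - inv_nat n) \<le> (1 / n) * (1 / n)"
        unfolding di norm_minus_cancel norm_mult I[of n] using I' by (intro mult_left_mono) auto
      also have "\<dots> \<le> 25 / real n ^ 2" by (simp add: power2_eq_square divide_right_mono)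
      finally show ?thesis .
    qed
    moreover have "norm (a (Suc n) - a n - (inv_nat (Suc n) - inv_nat n)) \<le> (100 / m * n) * (25 / real n ^ 2)"
    proof -
      have "a (Suc n) - a n - (inv_nat (Suc n) - inv_nat n) =
        (1 - q ^ n) * (a n * a (Suc n)) - (a n - inv_nat n) * a (Suc n) - inv_nat n * (a (Suc n) - inv_nat (Suc n))"
        unfolding da di by (simp add: algebra_simps)
      also have "norm \<dots> \<le> norm (1 - q ^ n) * norm (a n * a (Suc n)) +
        norm (a n - inv_nat n) * norm (a (Suc n)) + norm (inv_nat n) * norm (a (Suc n) - inv_nat (Suc n))"
        by (smt (verit) norm_mult norm_triangle_ineq4)
      also have "\<dots> \<le> (7 * n / m) * (25 / real n ^ 2) + (35 / m) * (5 / n) + (1 / n) * (35 / m)"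
        \<comment> \<open>The three summands have numerators 7 * 25, 35 * 5 and 35, in total 385,
          well below 100 * 25.\<close>
        using up[of n] aa B[OF nN(1)] B[OF nN(2)] A' I[of n] by (intro add_mono mult_mono) auto
      also have "\<dots> = 385 / (m * n)" using n m by (simp add: field_simps power2_eq_square)
      also have "\<dots> \<le> 2500 / (m * n)" by (intro divide_right_mono) auto
      also have "\<dots> = (100 / m * n) * (25 / real n ^ 2)" using n by (simp add: power2_eq_square)
      finally show ?thesis .
    qed
    ultimately show "rel_close (100 / m * n) (25 / real n ^ 2) (a (Suc n) - a n) (inv_nat (Suc n) - inv_nat n)"
      unfolding rel_close_def by blast
  qed (use m in auto)
qed

lemma inverse_one_minus_cis:
  assumes "sin y \<noteq> 0"
  shows "inverse (1 - cis (2 * y)) = of_real (1 / 2) + \<i> * of_real (cot y / 2)"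
proof (rule inverse_unique)
  show "(1 - cis (2 * y)) * (of_real (1 / 2) + \<i> * of_real (cot y / 2)) = 1"
    using assms sin_cos_squared_add[of y]
    by (simp add: complex_eq_iff cos_double_sin sin_double cot_def)
       (use assms sin_cos_squared_add[of y] in \<open>simp add: field_simps power2_eq_square\<close>)
qed

lemma complex_bigo_log_err_0:
  assumes "(\<lambda>m. Re (f m)) \<in> O(\<lambda>m. 1 / real m)" "(\<lambda>m. Im (f m)) \<in> O(\<lambda>m. 1 / real m)"
  shows "f \<in> O(log_err 0)"
proof -
  have "(\<lambda>m. of_real (Re (f m)) + \<i> * of_real (Im (f m))) \<in> O(log_err 0)"
    using assms by (intro sum_in_bigo) (simp_all add: of_real_in_log_err_0)
  then show ?thesis by (simp flip: complex_eq)
qed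

text \<open>Since 1 / [n] is (1 - q) (1 + \<i> cot (\<pi> n / m)) / 2, only the size of 1 - q
  matters: (1 - q) m is -2 \<pi> \<i> up to the error \<open>w\<close>. The constant part is summed
  over about m / 2 indices, which makes \<open>v\<close> close to 1 / 4 and yields -\<pi> \<i> / 2.
  The cotangent part acquires the factor 1 and yields the real logarithm; as it grows like log m,
  its product with \<open>w\<close> forces the exponent 1.\<close>

lemma q_sum_asymp:
  fixes M :: "nat \<Rightarrow> nat"
  assumes M: "\<And>m. m / 2 \<le> M m" "\<And>m. M m \<le> m / 2 + 1"
  shows "(\<lambda>m. (\<Sum>n\<in>{1..<M m}. inverse (q_int (cis (2 * pi / m)) n)) -
      (of_real (ln (m / pi)) + euler_mascheroni - of_real pi * \<i> / 2)) \<in> O(log_err 1)"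
proof -
  define w where "w m = (1 - cis (2 * pi / m)) * of_nat m + 2 * pi * \<i>" for m :: nat
  define v where "v m = (real (M m) - 1) / (2 * m)" for m
  define Z where "Z m = (\<Sum>n\<in>{1..<M m}. pi / m * cot (n * (pi / m)))" for m
  define L where "L m = ln (m / pi) + euler_mascheroni" for m :: nat
  have w: "w \<in> O(log_err 0)"
  proof (rule complex_bigo_log_err_0)
    have "(\<lambda>m. (1 - cos (2 * pi / real m)) * m) \<in> O(\<lambda>m. 1 / real m)" by real_asymp
    then show "(\<lambda>m. Re (w m)) \<in> O(\<lambda>m. 1 / real m)" by (simp add: w_def)
    have "(\<lambda>m. - sin (2 * pi / real m) * m + 2 * pi) \<in> O(\<lambda>m. 1 / real m)" by real_asymp
    then show "(\<lambda>m. Im (w m)) \<in> O(\<lambda>m. 1 / real m)" by (simp add: w_def)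
  qed
  have v: "(\<lambda>m. v m - 1 / 4) \<in> O(\<lambda>m. 1 / real m)"
  proof (rule bigoI[where c = 1], rule eventually_sequentiallyI[of 1])
    fix m :: nat assume m: "m \<ge> 1"
    have "v m - 1 / 4 = (real (M m) - 1 - m / 2) / (2 * m)" using m by (simp add: v_def field_simps)
    moreover have "\<bar>real (M m) - 1 - m / 2\<bar> \<le> 2" using M[of m] by (simp add: abs_le_iff)
    ultimately show "norm (v m - 1 / 4) \<le> 1 * norm (1 / real m)"
      using m by (simp add: divide_simps)
  qed
  have v0: "(\<lambda>m. complex_of_real (v m)) \<in> O(log_pow 0)"
  proof -
    have "(\<lambda>m. complex_of_real (v m - 1 / 4)) \<in> O(log_pow 0)"
      using v by (intro log_err_imp_log_pow) (simp only: of_real_in_log_err_0)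
    from sum_in_bigo(1)[OF this log_pow_0_const[of "1 / 4"]] show ?thesis by simp
  qed
  have ZL: "(\<lambda>m. complex_of_real (Z m - L m)) \<in> O(log_err 0)"
    using sum_cot_asymp[OF M] by (simp only: of_real_in_log_err_0 Z_def L_def)
  have "L \<in> O(\<lambda>m. ln (real m) ^ 1)" unfolding L_def[abs_def] by real_asymp
  then have "(\<lambda>m. complex_of_real (L m)) \<in> O(log_pow 1)"
    unfolding log_pow_def[abs_def] by (simp only: landau_o.big.of_real_iff)
  moreover have "(\<lambda>m. complex_of_real (Z m - L m)) \<in> O(log_pow 1)"
    using log_pow_mono[OF log_err_imp_log_pow[OF ZL]] by simp
  ultimately have "(\<lambda>m. complex_of_real (Z m - L m) + complex_of_real (L m)) \<in> O(log_pow 1)"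
    by (intro sum_in_bigo)
  then have Z: "(\<lambda>m. complex_of_real (Z m)) \<in> O(log_pow 1)" by simp
  have gen: "(x - d) * c * z = c * (z * x) - (c * d) * z" for x d c z :: complex
    by (simp add: algebra_simps)
  have 1: "(\<lambda>m. of_real (v m) * w m) \<in> O(log_err 1)"
    using log_err_mono[OF log_pow_mult_log_err[OF v0 w]] by simp
  have 2: "(\<lambda>m. 2 * pi * \<i> * of_real (v m - 1 / 4)) \<in> O(log_err 1)"
    using log_err_0_imp[OF v[unfolded of_real_in_log_err_0[symmetric]], of 1] by simp
  have 3: "(\<lambda>m. \<i> / (2 * pi) * (of_real (Z m) * w m)) \<in> O(log_err 1)"
    using log_pow_mult_log_err[OF Z w] by simp
  have 4: "(\<lambda>m. complex_of_real (Z m - L m)) \<in> O(log_err 1)"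
    by (rule log_err_0_imp[OF ZL])
  have "(\<lambda>m. of_real (v m) * w m - 2 * pi * \<i> * of_real (v m - 1 / 4) +
     \<i> / (2 * pi) * (of_real (Z m) * w m) + complex_of_real (Z m - L m)) \<in> O(log_err 1)"
    by (intro sum_in_bigo 1 2 3 4)
  moreover have "\<forall>\<^sub>F m in sequentially. of_real (v m) * w m - 2 * pi * \<i> * of_real (v m - 1 / 4) +
     \<i> / (2 * pi) * (of_real (Z m) * w m) + complex_of_real (Z m - L m) =
     (\<Sum>n\<in>{1..<M m}. inverse (q_int (cis (2 * pi / m)) n)) -
      (of_real (ln (m / pi)) + euler_mascheroni - of_real pi * \<i> / 2)"
  proof (rule eventually_sequentiallyI[of 4])
    fix m :: nat assume m: "m \<ge> 4"
    let ?q = "cis (2 * pi / m)"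
    have M1: "M m \<ge> 1" using M(1)[of m] m by (cases "M m") auto
    have "inverse (q_int ?q n) = (1 - ?q) * of_real (1 / 2) +
        (1 - ?q) * of_nat m * \<i> / (2 * pi) * of_real (pi / m * cot (n * (pi / m)))"
      if n: "n \<in> {1..<M m}" for n
    proof -
      have "real n \<le> real (M m) - 1" using n by (auto simp: of_nat_diff)
      then have "real n < m" using M(2)[of m] m by linarith
      then have "n * (pi / m) < pi" using m by (simp add: field_simps)
      moreover have "0 < n * (pi / m)" using n m by simp
      ultimately have "sin (n * (pi / m)) \<noteq> 0" using sin_gt_zero by (metis less_irrefl)
      from inverse_one_minus_cis[OF this]
      have "inverse (1 - ?q ^ n) = of_real (1 / 2) + \<i> * of_real (cot (n * (pi / m)) / 2)"
        by (simp add: Complex.DeMoivre mult_ac)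
      moreover have "inverse (q_int ?q n) = (1 - ?q) * inverse (1 - ?q ^ n)"
        unfolding q_int_def inverse_divide by (rule divide_inverse)
      ultimately have "inverse (q_int ?q n) = (1 - ?q) * (of_real (1 / 2) + \<i> * of_real (cot (n * (pi / m)) / 2))"
        by (simp only:)
      moreover have "(1 - ?q) * of_nat m * \<i> / (2 * pi) * of_real (pi / m * cot (n * (pi / m))) =
        (1 - ?q) * (\<i> * of_real (cot (n * (pi / m)) / 2))"
        using m by simp
      ultimately show ?thesis by (simp only: distrib_left)
    qed
    then have "(\<Sum>n\<in>{1..<M m}. inverse (q_int ?q n)) = of_nat (M m - 1) * ((1 - ?q) * of_real (1 / 2)) +
      (1 - ?q) * of_nat m * \<i> / (2 * pi) * of_real (Z m)"
      by (simp add: sum.distrib Z_def sum_distrib_left)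
    also have "of_nat (M m - 1) * ((1 - ?q) * of_real (1 / 2)) = of_real (v m) * ((1 - ?q) * of_nat m)"
      using m M1 by (simp add: v_def of_nat_diff field_simps)
    also have "(1 - ?q) * of_nat m = w m - 2 * pi * \<i>" by (simp add: w_def)
    finally have "(\<Sum>n\<in>{1..<M m}. inverse (q_int ?q n)) =
       of_real (v m) * (w m - 2 * pi * \<i>) + (w m - 2 * pi * \<i>) * \<i> / (2 * pi) * of_real (Z m)" .
    note * = this
    show "of_real (v m) * w m - 2 * pi * \<i> * of_real (v m - 1 / 4) +
     \<i> / (2 * pi) * (of_real (Z m) * w m) + complex_of_real (Z m - L m) =
     (\<Sum>n\<in>{1..<M m}. inverse (q_int ?q n)) -
      (of_real (ln (m / pi)) + euler_mascheroni - of_real pi * \<i> / 2)"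
    proof -
      have "x * \<i> / (2 * pi) = x * (\<i> / (2 * pi))" for x by simp
      then have "(w m - 2 * pi * \<i>) * \<i> / (2 * pi) * of_real (Z m) =
        (w m - 2 * pi * \<i>) * (\<i> / (2 * pi)) * of_real (Z m)" by (simp only:)
      also have "\<dots> = \<i> / (2 * pi) * (of_real (Z m) * w m) - (\<i> / (2 * pi) * (2 * pi * \<i>)) * of_real (Z m)"
        by (rule gen)
      also have "\<i> / (2 * pi) * (2 * pi * \<i>) = - 1" by simp
      finally have **: "(w m - 2 * pi * \<i>) * \<i> / (2 * pi) * of_real (Z m) =
        \<i> / (2 * pi) * (of_real (Z m) * w m) - (- 1) * of_real (Z m)" .
      have "2 * pi * \<i> * of_real (v m - 1 / 4) = 2 * pi * \<i> * of_real (v m) - of_real pi * \<i> / 2"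
        by (simp add: right_diff_distrib)
      then show ?thesis unfolding * ** by (simp add: L_def right_diff_distrib)
    qed
  qed
  ultimately show ?thesis using landau_o.big.in_cong by fast
qed

lemma family_q:
  fixes M :: "nat \<Rightarrow> nat"
  assumes M: "\<And>m. m / 2 \<le> M m" "\<And>m. M m \<le> m / 2 + 1"
  shows "family 25 (\<lambda>m n. inverse (q_int (cis (2 * pi / m)) n)) M
    (\<lambda>m. of_real (ln (m / pi)) + euler_mascheroni - of_real pi * \<i> / 2)"
  unfolding family_def
proof
  show "\<exists>D. \<forall>\<^sub>F m in sequentially. perturbed_inv (D / real m) 25 (M m) (\<lambda>n. inverse (q_int (cis (2 * pi / m)) n)) \<and>
      M m \<le> m \<and> real m \<le> 25 * real (M m)"
  \<comment> \<open>From m \<ge> 4 on, the cut m / 2 + 1 is at most 3 m / 4, the range in which the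
    reciprocals are under control.\<close>
  proof (rule exI[of _ 100], rule eventually_sequentiallyI[of 4], intro conjI)
    fix m :: nat assume m: "m \<ge> 4"
    show "perturbed_inv (100 / real m) 25 (M m) (\<lambda>n. inverse (q_int (cis (2 * pi / m)) n))"
      using q_perturbed_inv[OF m, of "M m"] M(2)[of m] m by simp
    have "real (M m) \<le> m" using M(2)[of m] m by simp
    then show "M m \<le> m" by simp
    show "real m \<le> 25 * real (M m)" using M(1)[of m] by simp
  qed
  show "(\<lambda>m. csum (\<lambda>n. inverse (q_int (cis (2 * pi / m)) n)) (M m) [(1, 1)] -
      (of_real (ln (m / pi)) + euler_mascheroni - of_real pi * \<i> / 2)) \<in> O(log_err 1)"
    using q_sum_asymp[OF M] by (simp add: csum_Cons letter_def)
qed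

section \<open>The regularized polynomials\<close>

lemma log_err_tendsto_0:
  assumes "f \<in> O(log_err J)"
  shows "f \<longlonglongrightarrow> 0"
proof -
  obtain c where c: "\<forall>\<^sub>F m in sequentially. norm (f m) \<le> c * norm (log_err J m)"
    using assms by (elim landau_o.bigE)
  have "(\<lambda>m::nat. ln (real m) ^ J / real m) \<longlonglongrightarrow> 0" by real_asymp
  then have "(\<lambda>m. complex_of_real (ln (real m) ^ J / real m)) \<longlonglongrightarrow> of_real 0"
    by (rule tendsto_of_real)
  then have "log_err J \<longlonglongrightarrow> 0"
    unfolding log_err_def[abs_def] of_real_0 .
  then have "(\<lambda>m. c * norm (log_err J m)) \<longlonglongrightarrow> c * norm (0 :: complex)" by (intro tendsto_intros)
  with c show ?thesis by (intro Lim_null_comparison[of f]) auto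
qed

text \<open>The arguments leave every bounded set, and there a nonconstant polynomial is unbounded.
  This is the uniqueness behind \<open>L_star\<close>.\<close>

lemma poly_eq_0_if_tendsto_0:
  fixes R :: "complex poly"
  assumes "(\<lambda>m. poly R (of_real (ln (real m)) + c)) \<longlonglongrightarrow> 0"
  shows "R = 0"
proof (cases "degree R = 0")
  case True
  then obtain b where b: "R = [:b:]" by (elim degree_eq_zeroE)
  with assms show ?thesis by (simp add: tendsto_const_iff)
next
  case False
  have "filterlim (\<lambda>m::nat. ln (real m) - norm c) at_top sequentially" by real_asymp
  then have "filterlim (\<lambda>m. norm (of_real (ln (real m)) + c)) at_top sequentially"
  proof (rule filterlim_at_top_mono, intro always_eventually allI)
    fix m
    show "ln (real m) - norm c \<le> norm (of_real (ln (real m)) + c)"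
      using norm_diff_ineq[of "of_real (ln (real m))" c] by simp
  qed
  then have "filterlim (\<lambda>m. of_real (ln (real m)) + c) at_infinity sequentially"
    by (simp add: filterlim_at_infinity_conv_norm_at_top)
  moreover have "filterlim (poly R) at_infinity at_infinity"
    using False by (intro filterlim_poly_at_infinity) auto
  ultimately have "filterlim (\<lambda>m. poly R (of_real (ln (real m)) + c)) at_infinity sequentially"
    by (rule filterlim_compose[rotated])
  with assms show ?thesis using not_tendsto_and_filterlim_at_infinity by force
qed

lemma log_err_eq: "(\<lambda>m. of_real (ln (real m) ^ J / real m)) = log_err J"
  by (simp add: log_err_def[abs_def])

lemma cnj_euler_mascheroni: "cnj euler_mascheroni = euler_mascheroni"
  by (metis of_real_euler_mascheroni complex_cnj_complex_of_real)

lemma L_trunc_eq_csum: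
  "length \<eta>s = length ks \<Longrightarrow> L_trunc m \<eta>s ks = csum inv_nat m (zip \<eta>s ks)"
  unfolding L_trunc_def by (subst sum_dec_tuples_eq_csum) (simp_all add: inv_nat_def[abs_def] inverse_eq_divide)

lemma z_trunc_eq_csum:
  "length \<eta>s = length ks \<Longrightarrow> z_trunc m \<eta>s ks q = csum (\<lambda>n. inverse (q_int q n)) m (zip \<eta>s ks)"
  unfolding z_trunc_def by (subst sum_dec_tuples_eq_csum) simp_all

lemma L_star_eqI:
  assumes "length \<eta>s = length ks"
    and P: "(\<lambda>m. csum inv_nat m (zip \<eta>s ks) - poly P (of_real (ln (real m)) + euler_mascheroni)) \<in> O(log_err J)"
  shows "L_star \<eta>s ks = P"
  unfolding L_star_def log_err_eq L_trunc_eq_csum[OF assms(1)]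
proof (rule the_equality)
  show "\<exists>J>0. (\<lambda>m. csum inv_nat m (zip \<eta>s ks) - poly P (of_real (ln (real m)) + euler_mascheroni)) \<in> O(log_err J)"
    \<comment> \<open>The definition of \<open>L_star\<close> asks for a positive exponent, while
      the given \<open>J\<close> may be 0.\<close>
    by (intro exI[of _ "Suc J"] conjI log_err_mono[OF P]) auto
next
  fix Q assume "\<exists>J>0. (\<lambda>m. csum inv_nat m (zip \<eta>s ks) - poly Q (of_real (ln (real m)) + euler_mascheroni)) \<in> O(log_err J)"
  then obtain J' where Q: "(\<lambda>m. csum inv_nat m (zip \<eta>s ks) - poly Q (of_real (ln (real m)) + euler_mascheroni)) \<in> O(log_err J')"
    by blast
  from tendsto_diff[OF log_err_tendsto_0[OF P] log_err_tendsto_0[OF Q]]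
  have "(\<lambda>m. poly (Q - P) (of_real (ln (real m)) + euler_mascheroni)) \<longlonglongrightarrow> 0" by simp
  then have "Q - P = 0" by (rule poly_eq_0_if_tendsto_0)
  then show "Q = P" by simp
qed

lemma weight_zip: "length \<eta>s = length ks \<Longrightarrow> weight (zip \<eta>s ks) = sum_list ks"
  by (simp add: weight_def)

text \<open>The polynomial does not depend on the family, so evaluating at the coefficients 1 / n
  identifies it as \<open>L_star\<close>, and this identification carries over to every other
  family.\<close>

theorem csum_family_L_star:
  assumes len: "length \<eta>s = length ks" and w: "index_word (zip \<eta>s ks)" and fam: "family C a M T"
    and C: "1 \<le> C"
  shows "(\<lambda>m. csum (a m) (M m) (zip \<eta>s ks) - poly (L_star \<eta>s ks) (T m)) \<in> O(log_err (sum_list ks))"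
proof -
  obtain P where P: "\<And>a M T. family C a M T \<Longrightarrow>
    (\<lambda>m. csum (a m) (M m) (zip \<eta>s ks) - poly P (T m)) \<in> O(log_err (sum_list ks))"
    using csum_family_asymptotics[OF C w] weight_zip[OF len] by auto
  have "L_star \<eta>s ks = P"
    by (rule L_star_eqI[OF len P[OF family_inv_nat[OF C]]])
  with P[OF fam] show ?thesis by simp
qed

section \<open>Reflecting and cutting the q-sum\<close>

lemma q_int_reflect:
  fixes m n :: nat
  assumes "n \<le> m" "m > 0"
  defines "q \<equiv> cis (2 * pi / m)"
  shows "inverse (q_int q (m - n)) = - q * cnj (inverse (q_int q n))"
proof -
  have qm: "q ^ m = 1" using assms(2) by (simp add: q_def Complex.DeMoivre)
  have qq: "q * cnj q = 1" by (simp add: q_def cis_cnj cis_mult)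
  have "q ^ (m - n) = q ^ (m - n) * (q * cnj q) ^ n" using qq by simp
  also have "\<dots> = q ^ (m - n + n) * cnj q ^ n" by (simp add: power_add power_mult_distrib)
  also have "\<dots> = cnj q ^ n" using assms(1) qm by simp
  finally have r: "q ^ (m - n) = cnj q ^ n" .
  have "1 - q = - q * (1 - cnj q)" using qq by (simp add: algebra_simps)
  then have "inverse (q_int q (m - n)) = - q * (1 - cnj q) / (1 - cnj q ^ n)"
    by (simp add: q_int_def r)
  then show ?thesis by (simp add: q_int_def)
qed

text \<open>At the reflected index \<eta>^(m - n) is \<eta>^m times the n-th power of the conjugate
  of \<eta>, and the reciprocal becomes -q times a conjugate. Each letter therefore releases the
  scalar (-q)^k \<eta>^m, which does not depend on n and leaves the sum.\<close>

lemma csum_q_upper: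
  fixes m :: nat
  assumes "l \<le> m" "m > 0" "index_word w"
  defines "a \<equiv> \<lambda>n. inverse (q_int (cis (2 * pi / m)) n)"
  shows "iter_sum l m (map (letter a) w) =
    prod_list (map (\<lambda>x. (- cis (2 * pi / m)) ^ snd x * fst x ^ m) w) *
    csum (\<lambda>n. cnj (a n)) (Suc m - l) (map (map_prod cnj id) (rev w))"
proof -
  let ?c = "\<lambda>x :: complex \<times> nat. (- cis (2 * pi / m)) ^ snd x * fst x ^ m"
  let ?b = "\<lambda>n. cnj (a n)"
  have *: "letter a x (m - n) = ?c x * letter ?b (map_prod cnj id x) n"
    if "x \<in> set w" "n \<in> {1..<Suc m - l}" for x n
  proof -
    have n: "n \<le> m" using that by auto
    have "norm (fst x) = 1" using that assms(3) by (simp add: index_word_def)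
    then have u: "fst x * cnj (fst x) = 1" by (simp add: complex_norm_square[symmetric])
    have "fst x ^ (m - n) = fst x ^ (m - n) * (fst x * cnj (fst x)) ^ n" using u by simp
    also have "\<dots> = fst x ^ (m - n + n) * cnj (fst x) ^ n" by (simp add: power_add power_mult_distrib)
    finally have "fst x ^ (m - n) = fst x ^ m * cnj (fst x) ^ n" using n by simp
    moreover have "a (m - n) = - cis (2 * pi / m) * ?b n"
      unfolding a_def using q_int_reflect[OF n assms(2)] .
    ultimately show ?thesis
      by (simp only: letter_def fst_map_prod snd_map_prod id_apply power_mult_distrib mult_ac)
  qed
  have "iter_sum l m (map (letter a) w) =
    iter_sum 1 (Suc m - l) (rev (map (\<lambda>f n. f (m - n)) (map (letter a) w)))"
    using iter_sum_reflect[of m m l "map (letter a) w"] assms(1) by simp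
  also have "\<dots> = iter_sum 1 (Suc m - l) (map (\<lambda>x n. ?c x * letter ?b (map_prod cnj id x) n) (rev w))"
    unfolding rev_map[symmetric] map_map comp_def
    by (rule iter_sum_cong) (use * in \<open>auto simp: list_all2_conv_all_nth rev_nth\<close>)
  also have "\<dots> = prod_list (map ?c (rev w)) * csum ?b (Suc m - l) (map (map_prod cnj id) (rev w))"
    unfolding iter_sum_scale csum_def map_map comp_def ..
  also have "prod_list (map ?c (rev w)) = prod_list (map ?c w)"
    by (simp flip: rev_map)
  finally show ?thesis .
qed

text \<open>Cutting at the ceiling of m / 2 leaves a reflected upper part with indices from 1 to
  \<open>m div 2\<close>. Both cutoffs, \<open>m div 2 + 1\<close> and \<open>(m + 1) div 2\<close>,
  lie between m / 2 and m / 2 + 1, as \<open>family_q\<close> requires.\<close>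

lemma csum_q_split:
  fixes m :: nat
  assumes "m > 0" "index_word w"
  defines "a \<equiv> \<lambda>n. inverse (q_int (cis (2 * pi / m)) n)"
  shows "csum a m w = (\<Sum>j\<le>length w.
    prod_list (map (\<lambda>x. (- cis (2 * pi / m)) ^ snd x * fst x ^ m) (take j w)) *
    csum (\<lambda>n. cnj (a n)) (m div 2 + 1) (map (map_prod cnj id) (rev (take j w))) *
    csum a ((m + 1) div 2) (drop j w))"
proof -
  define M where "M = (m + 1) div 2"
  have M: "1 \<le> M" "M \<le> m" "Suc m - M = m div 2 + 1" using assms(1) by (auto simp: M_def)
  have "csum a m w = (\<Sum>j\<le>length w. iter_sum M m (map (letter a) (take j w)) * csum a M (drop j w))"
    unfolding csum_def using iter_sum_split[OF M(1,2), of "map (letter a) w"] by (simp add: take_map drop_map)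
  moreover have "iter_sum M m (map (letter a) (take j w)) =
    prod_list (map (\<lambda>x. (- cis (2 * pi / m)) ^ snd x * fst x ^ m) (take j w)) *
    csum (\<lambda>n. cnj (a n)) (m div 2 + 1) (map (map_prod cnj id) (rev (take j w)))" for j
  proof -
    have "index_word (take j w)" using assms(2) by (auto simp: index_word_def dest: in_set_takeD)
    from csum_q_upper[OF M(2) assms(1) this] show ?thesis unfolding a_def M(3) .
  qed
  ultimately show ?thesis by (simp only: M_def)
qed

lemma prod_list_powers:
  fixes z :: complex
  assumes "length \<eta>s = length ks"
  shows "prod_list (map (\<lambda>x. z ^ snd x * fst x ^ m) (zip \<eta>s ks)) = z ^ sum_list ks * prod_list \<eta>s ^ m"
  using assms by (induction \<eta>s ks rule: list_induct2) (auto simp: power_add power_mult_distrib mult_ac)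

lemma norm_prod_list_1: "(\<forall>x\<in>set xs. norm (x :: complex) = 1) \<Longrightarrow> norm (prod_list xs) = 1"
  by (induction xs) (auto simp: norm_mult)

text \<open>The scalars (-q)^k of the reflection multiply to a sign times a power of q with an
  exponent independent of m, and this estimate removes that power.\<close>

lemma cis_power_minus_1: "(\<lambda>m::nat. cis (2 * pi / m) ^ K - 1) \<in> O(log_err 0)"
proof (rule bigoI[where c = "2 * pi * K"], rule always_eventually, rule allI)
  fix m :: nat
  have "cis (2 * pi / m) ^ K = cis (2 * pi * K / m)" by (simp add: Complex.DeMoivre mult_ac)
  then show "norm (cis (2 * pi / m) ^ K - 1) \<le> 2 * pi * K * norm (log_err 0 m)"
    using norm_one_minus_cis_le[of "2 * pi * K / m"] by (simp add: log_err_0 norm_minus_commute norm_divide)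
qed

theorem theorem2p2:
  fixes ks :: "nat list"
  assumes "\<forall>k\<in>set ks. k > 0"
  shows "\<exists>J>0. \<forall>N\<ge>1. \<forall>\<eta>s :: complex list.
    length \<eta>s = length ks \<longrightarrow> set \<eta>s \<subseteq> roots_of_unity N \<longrightarrow>
    (\<lambda>m::nat. z_trunc m \<eta>s ks (exp (2 * of_real pi * \<i> / of_nat m)) -
       (\<Sum>j=0..length ks.
          (- 1) ^ sum_list (take j ks) * prod_list (take j \<eta>s) ^ m *
          poly (L_star (map cnj (rev (take j \<eta>s))) (rev (take j ks)))
            (of_real (ln (real m / pi)) + euler_mascheroni + of_real pi * \<i> / 2) *
          poly (L_star (drop j \<eta>s) (drop j ks))
            (of_real (ln (real m / pi)) + euler_mascheroni - of_real pi * \<i> / 2)))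
      \<in> O(\<lambda>m. of_real (ln (real m) ^ J / real m))"
proof (rule exI[of _ "2 * sum_list ks + 1"], intro conjI allI impI)
  define W where "W = sum_list ks"
  fix N :: nat and \<eta>s :: "complex list"
  assume N: "1 \<le> N" and len: "length \<eta>s = length ks" and \<eta>s: "set \<eta>s \<subseteq> roots_of_unity N"
  have norm1: "norm \<eta> = 1" if "\<eta> \<in> set \<eta>s" for \<eta>
  proof -
    have "norm \<eta> ^ N = 1" using that \<eta>s by (auto simp: roots_of_unity_def simp flip: norm_power)
    then show ?thesis using N power_eq_1_iff[of "norm \<eta>" N] by simp
  qed
  let ?w = "zip \<eta>s ks"
  have w: "index_word ?w"
    unfolding index_word_def using assms norm1 by (auto dest: set_zip_leftD set_zip_rightD)
  define a :: "nat \<Rightarrow> nat \<Rightarrow> complex" where "a m n = inverse (q_int (cis (2 * pi / m)) n)" for m n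
  define T :: "nat \<Rightarrow> complex" where
    "T m = of_real (ln (m / pi)) + euler_mascheroni - of_real pi * \<i> / 2" for m
  have fam1: "family 25 a (\<lambda>m. (m + 1) div 2) T"
    unfolding a_def[abs_def] T_def[abs_def] by (rule family_q) (auto simp: field_simps)
  have "family 25 a (\<lambda>m. m div 2 + 1) T"
    unfolding a_def[abs_def] T_def[abs_def] by (rule family_q) (auto simp: field_simps)
  note fam2 = family_cnj[OF this]
  define A where "A j m = poly (L_star (map cnj (rev (take j \<eta>s))) (rev (take j ks))) (cnj (T m))" for j m
  define B where "B j m = poly (L_star (drop j \<eta>s) (drop j ks)) (T m)" for j m
  define S1 where "S1 j m = csum (\<lambda>n. cnj (a m n)) (m div 2 + 1) (map (map_prod cnj id) (rev (take j ?w)))" for j m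
  define S2 where "S2 j m = csum (a m) ((m + 1) div 2) (drop j ?w)" for j m
  \<comment> \<open>\<open>c0\<close> is the coefficient of the final formula and \<open>c\<close>
    the one that the exact splitting produces; they differ by a power of q.\<close>
  define c0 where "c0 j m = (- 1) ^ sum_list (take j ks) * prod_list (take j \<eta>s) ^ m" for j m
  define c where "c j m = c0 j m * cis (2 * pi / real m) ^ sum_list (take j ks)" for j m
  have part: "sum_list (take j ks) \<le> W" "sum_list (drop j ks) \<le> W" for j
    unfolding W_def by (metis append_take_drop_id le_add1 sum_list.append, metis append_take_drop_id le_add2 sum_list.append)
  have wt: "index_word (map (map_prod cnj id) (rev (take j ?w)))" "index_word (drop j ?w)" for j
    using w by (auto simp: index_word_def dest: in_set_takeD in_set_dropD)
  have v: "map (map_prod cnj id) (rev (take j ?w)) = zip (map cnj (rev (take j \<eta>s))) (rev (take j ks))" for j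
    using len by (simp add: take_zip zip_rev zip_map1 map_prod_def id_def)
  have d: "drop j ?w = zip (drop j \<eta>s) (drop j ks)" for j by (rule drop_zip)
  have S1: "S1 j \<in> O(log_pow W)" "(\<lambda>m. S1 j m - A j m) \<in> O(log_err W)" for j
  proof -
    have "length (map (map_prod cnj id) (rev (take j ?w))) \<le> W"
      using length_le_weight[OF wt(1)[of j]] part(1)[of j] len unfolding v
      by (simp add: weight_zip)
    from log_pow_mono[OF csum_family_log_pow[OF fam2 wt(1)[of j]] this]
    show "S1 j \<in> O(log_pow W)" by (simp add: S1_def[abs_def])
    show "(\<lambda>m. S1 j m - A j m) \<in> O(log_err W)"
      unfolding S1_def A_def v
      by (rule log_err_mono[OF csum_family_L_star[OF _ wt(1)[of j, unfolded v] fam2]]) (use part len in auto)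
  qed
  have S2: "S2 j \<in> O(log_pow W)" "(\<lambda>m. S2 j m - B j m) \<in> O(log_err W)" for j
  proof -
    have "length (drop j ?w) \<le> W"
      using length_le_weight[OF wt(2)[of j]] part(2)[of j] len unfolding d
      by (simp add: weight_zip)
    from log_pow_mono[OF csum_family_log_pow[OF fam1 wt(2)[of j]] this]
    show "S2 j \<in> O(log_pow W)" by (simp add: S2_def[abs_def])
    show "(\<lambda>m. S2 j m - B j m) \<in> O(log_err W)"
      unfolding S2_def B_def d
      by (rule log_err_mono[OF csum_family_L_star[OF _ wt(2)[of j, unfolded d] fam1]]) (use part len in auto)
  qed
  have A: "A j \<in> O(log_pow W)" for j
    using sum_in_bigo(2)[OF S1(1) log_err_imp_log_pow[OF S1(2)], of j j] by simp
  have c0: "c0 j \<in> O(log_pow 0)" for j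
  proof (rule bigoI[where c = 1], rule always_eventually, rule allI)
    fix m
    have "norm (prod_list (take j \<eta>s)) = 1"
      using norm1 by (intro norm_prod_list_1) (auto dest: in_set_takeD)
    then show "norm (c0 j m) \<le> 1 * norm (log_pow 0 m)"
      by (simp add: c0_def norm_mult norm_power log_pow_def)
  qed
  have W2: "2 * W = W + W + (0 + 0)" "2 * W = 0 + (W + W)" by simp_all
  have "(\<lambda>m. c j m * (S1 j m * S2 j m) - c0 j m * (A j m * B j m)) \<in> O(log_err (2 * W))" for j
  proof -
    \<comment> \<open>The three factors are replaced one at a time: \<open>c\<close> by
      \<open>c0\<close>, then \<open>S1\<close> by \<open>A\<close>, then \<open>S2\<close> by
      \<open>B\<close>. Each replacement costs at most log^W m / m and is multiplied by at most two
      factors of order log^W m; the power of q costs only 1 / m, so 2 W is enough in all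
      cases.\<close>
    have "(\<lambda>m. (S1 j m * S2 j m) * (c0 j m * (cis (2 * pi / real m) ^ sum_list (take j ks) - 1))) \<in> O(log_err (2 * W))"
      unfolding W2(1) by (rule log_pow_mult_log_err[OF log_pow_mult[OF S1(1) S2(1)] log_pow_mult_log_err[OF c0 cis_power_minus_1]])
    moreover have "(\<lambda>m. c0 j m * (S2 j m * (S1 j m - A j m))) \<in> O(log_err (2 * W))"
      unfolding W2(2) by (rule log_pow_mult_log_err[OF c0 log_pow_mult_log_err[OF S2(1) S1(2)]])
    moreover have "(\<lambda>m. c0 j m * (A j m * (S2 j m - B j m))) \<in> O(log_err (2 * W))"
      unfolding W2(2) by (rule log_pow_mult_log_err[OF c0 log_pow_mult_log_err[OF A S2(2)]])
    ultimately have "(\<lambda>m. (S1 j m * S2 j m) * (c0 j m * (cis (2 * pi / real m) ^ sum_list (take j ks) - 1)) +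
      c0 j m * (S2 j m * (S1 j m - A j m)) + c0 j m * (A j m * (S2 j m - B j m))) \<in> O(log_err (2 * W))"
      by (intro sum_in_bigo)
    then show ?thesis by (simp add: c_def algebra_simps)
  qed
  then have "(\<lambda>m. \<Sum>j\<le>length ks. c j m * (S1 j m * S2 j m) - c0 j m * (A j m * B j m)) \<in> O(log_err (2 * W))"
    by (rule big_sum_in_bigo)
  \<comment> \<open>The exponent has to be positive also for the empty index, where \<open>W\<close>
    is 0.\<close>
  then have main: "(\<lambda>m. \<Sum>j\<le>length ks. c j m * (S1 j m * S2 j m) - c0 j m * (A j m * B j m)) \<in> O(log_err (2 * W + 1))"
    by (rule log_err_mono) simp
  have "\<forall>\<^sub>F m in sequentially. (\<Sum>j\<le>length ks. c j m * (S1 j m * S2 j m) - c0 j m * (A j m * B j m)) =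
    z_trunc m \<eta>s ks (exp (2 * of_real pi * \<i> / of_nat m)) -
       (\<Sum>j=0..length ks.
          (- 1) ^ sum_list (take j ks) * prod_list (take j \<eta>s) ^ m *
          poly (L_star (map cnj (rev (take j \<eta>s))) (rev (take j ks)))
            (of_real (ln (real m / pi)) + euler_mascheroni + of_real pi * \<i> / 2) *
          poly (L_star (drop j \<eta>s) (drop j ks))
            (of_real (ln (real m / pi)) + euler_mascheroni - of_real pi * \<i> / 2))"
  proof (rule eventually_sequentiallyI[of 1])
    fix m :: nat assume m: "1 \<le> m"
    have "exp (2 * of_real pi * \<i> / of_nat m) = cis (2 * pi / m)"
      by (simp add: cis_conv_exp mult_ac)
    then have "z_trunc m \<eta>s ks (exp (2 * of_real pi * \<i> / of_nat m)) = csum (a m) m ?w"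
      by (simp add: z_trunc_eq_csum[OF len] a_def[abs_def])
    also have "\<dots> = (\<Sum>j\<le>length ks. c j m * (S1 j m * S2 j m))"
    proof -
      have "prod_list (map (\<lambda>x. (- cis (2 * pi / m)) ^ snd x * fst x ^ m) (take j ?w)) = c j m" for j
        unfolding take_zip by (subst prod_list_powers)
          (use len in \<open>simp_all add: c_def c0_def power_minus[of "cis _"] mult_ac\<close>)
      then show ?thesis
        using csum_q_split[of m ?w] m w len by (simp add: a_def[abs_def] S1_def S2_def mult.assoc)
    qed
    finally show "(\<Sum>j\<le>length ks. c j m * (S1 j m * S2 j m) - c0 j m * (A j m * B j m)) =
      z_trunc m \<eta>s ks (exp (2 * of_real pi * \<i> / of_nat m)) -
       (\<Sum>j=0..length ks.
          (- 1) ^ sum_list (take j ks) * prod_list (take j \<eta>s) ^ m *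
          poly (L_star (map cnj (rev (take j \<eta>s))) (rev (take j ks)))
            (of_real (ln (real m / pi)) + euler_mascheroni + of_real pi * \<i> / 2) *
          poly (L_star (drop j \<eta>s) (drop j ks))
            (of_real (ln (real m / pi)) + euler_mascheroni - of_real pi * \<i> / 2))"
      by (simp add: sum_subtractf c0_def A_def B_def T_def cnj_euler_mascheroni atMost_atLeast0 mult.assoc)
  qed
  with main show "(\<lambda>m::nat. z_trunc m \<eta>s ks (exp (2 * of_real pi * \<i> / of_nat m)) -
       (\<Sum>j=0..length ks.
          (- 1) ^ sum_list (take j ks) * prod_list (take j \<eta>s) ^ m *
          poly (L_star (map cnj (rev (take j \<eta>s))) (rev (take j ks)))
            (of_real (ln (real m / pi)) + euler_mascheroni + of_real pi * \<i> / 2) *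
          poly (L_star (drop j \<eta>s) (drop j ks))
            (of_real (ln (real m / pi)) + euler_mascheroni - of_real pi * \<i> / 2)))
      \<in> O(\<lambda>m. of_real (ln (real m) ^ (2 * sum_list ks + 1) / real m))"
    unfolding W_def log_err_eq using landau_o.big.in_cong by fast
qed simp

end
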